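(* Let $1\le p<\infty$, let $X,E$ be Banach spaces and let $T:X\to E$ be a (bounded) linear operator. The following are equivalent. (1) $T$ is Lipschitz $p$-summing. (2) $T$ is $p$-summing. (3) $T$ is strictly Lipschitz $p$-summing. In this case $\|T\|_{\Pi_p}=\|T\|_{\Pi_p^{L}}=\|T\|_{\Pi_p^{SL}}$.
   Context: All spaces are real. A Banach space $X$ is regarded as a pointed metric space with distinguished point $0$. $Lip_0(X;E)$ is the space of Lipschitz maps $T:X\to E$ with $T(0)=0$; $X^{\#}=Lip_0(X;\mathbb{R})$ with norm the best Lipschitz constant $Lip(f)$. For $x,y\in X$, $\delta_{(x,y)}:X^{\#}\to\mathbb{R}$ is $\delta_{(x,y)}(f)=f(x)-f(y)$. $\mathcal{F}(X)$ is the completion of the linear span of the $\delta_{(x,y)}$ under $\|m\|_{\mathcal{F}(X)}=\inf\{\sum_i|\lambda_i|d(x_i,y_i): m=\sum_i\lambda_i\delta_{(x_i,y_i)}\}$. Let $p^*$ be the conjugate exponent of $p$. For a finite sequence in a Banach space $F$ put $\|(x_i)\|_{l_p^n(F)}=(\sum_i\|x_i\|^p)^{1/p}$ (max for $p=\infty$) and $\|(x_i)\|_{l_p^{n,w}(F)}=\sup_{\|x^*\|\le 1}(\sum_i|x^*(x_i)|^p)^{1/p}$. For $u\in F\otimes G$, $$d_p(u)=\inf\Big\{\|(x_i)\|_{l_p^{n,w}(F)}\|(g_i)\|_{l_{p^*}^n(G)}: u=\sum_{i=1}^n x_i\otimes g_i\Big\}.$$ A linear operator $S:F\to G$ is $p$-summing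 if there is $C>0$ with $|\sum_i\langle S(x_i),g_i^*\rangle|\le C\,d_p(\sum_i x_i\otimes g_i^* )$ for all $x_i\in F$, $g_i^*\in G^*$; $\|S\|_{\Pi_p}$ is the least such $C$. A map $T\in Lip_0(X;E)$ is Lipschitz $p$-summing if there is $C>0$ with $\sum_{i=1}^n\|T(x_i)-T(y_i)\|^p\le C^p\sup_{Lip(f)\le1}\sum_{i=1}^n|f(x_i)-f(y_i)|^p$ for all $x_i,y_i\in X$ (supremum over $f\in X^{\#}$); $\|T\|_{\Pi_p^L}$ is the least such $C$. $X\boxtimes E^*$ is the linear span of the functionals $\delta_{(x,y)}\boxtimes e^*$ on $Lip_0(X;E^{**})$ given by $(\delta_{(x,y)}\boxtimes e^* )(f)=\langle f(x)-f(y),e^*\rangle$. For $u=\sum_i\delta_{(x_i,y_i)}\boxtimes e_i^*$ put $d_p^L(u)=d_p(\Phi(u))$, $\Phi(u)=\sum_i\delta_{(x_i,y_i)}\otimes e_i^*\in\mathcal{F}(X)\otimes E^*$. A map $T\in Lip_0(X;E)$ is strictly Lipschitz $p$-summing if there is $C>0$ such that $|\sum_i\langle T(x_i)-T(y_i),e_i^*\rangle|\le C\,d_p^L(\sum_i\delta_{(x_i,y_i)}\boxtimes e_i^* )$ for all $x_i,y_i\in X$, $e_i^*\in E^*$; $\|T\|_{\Pi_p^{SL}}$ is the least such $C$. *)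

theory Defs
  imports "HOL-Analysis.Analysis"
begin

section \<open>The vector space of real functions on an index type\<close>

typedef 'i rfun = "UNIV :: ('i \<Rightarrow> real) set"
  morphisms rapp RFun by simp

setup_lifting type_definition_rfun

instantiation rfun :: (type) real_vector
begin
lift_definition zero_rfun :: "'i rfun" is "\<lambda>_. 0" .
lift_definition plus_rfun :: "'i rfun \<Rightarrow> 'i rfun \<Rightarrow> 'i rfun" is "\<lambda>u v f. u f + v f" .
lift_definition minus_rfun :: "'i rfun \<Rightarrow> 'i rfun \<Rightarrow> 'i rfun" is "\<lambda>u v f. u f - v f" .
lift_definition uminus_rfun :: "'i rfun \<Rightarrow> 'i rfun" is "\<lambda>u f. - u f" .
lift_definition scaleR_rfun :: "real \<Rightarrow> 'i rfun \<Rightarrow> 'i rfun" is "\<lambda>c u f. c * u f" .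
instance by standard (transfer; auto simp: fun_eq_iff algebra_simps)+
end

lemma rapp_simps [simp]:
  "rapp 0 f = 0" "rapp (u + v) f = rapp u f + rapp v f" "rapp (u - v) f = rapp u f - rapp v f"
  "rapp (- u) f = - rapp u f" "rapp (c *\<^sub>R u) f = c * rapp u f" "rapp (RFun h) f = h f"
  by (transfer; simp)+

lemma rapp_sum [simp]: "rapp (\<Sum>i\<in>I. u i) f = (\<Sum>i\<in>I. rapp (u i) f)"
  by (induction I rule: infinite_finite_induct) auto

lemma rfun_eqI: "(\<And>f. rapp u f = rapp v f) \<Longrightarrow> u = v"
  by transfer auto

lemma sum_lessThan_add:
  fixes g :: "nat \<Rightarrow> 'c::comm_monoid_add"
  shows "(\<Sum>i<n+m. g i) = (\<Sum>i<n. g i) + (\<Sum>i<m. g (n + i))"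
  by (induction m) (auto simp: add.assoc)

section \<open>Completion of a normed space\<close>

definition cauchy_equiv :: "(nat \<Rightarrow> 'a::real_normed_vector) \<Rightarrow> (nat \<Rightarrow> 'a) \<Rightarrow> bool" where
  "cauchy_equiv s t \<longleftrightarrow> Cauchy s \<and> Cauchy t \<and> (\<lambda>n. s n - t n) \<longlonglongrightarrow> 0"

lemma cauchy_equiv_part: "part_equivp (cauchy_equiv :: (nat \<Rightarrow> 'a::real_normed_vector) \<Rightarrow> _)"
proof (rule part_equivpI)
  have "cauchy_equiv (\<lambda>_. 0) (\<lambda>_. 0::'a)"
    by (simp add: cauchy_equiv_def convergent_const convergent_Cauchy)
  then show "\<exists>s::nat\<Rightarrow>'a. cauchy_equiv s s" by blast
  show "symp (cauchy_equiv :: (nat \<Rightarrow> 'a) \<Rightarrow> _)"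
  proof (rule sympI)
    fix s t :: "nat \<Rightarrow> 'a" assume "cauchy_equiv s t"
    then show "cauchy_equiv t s"
      using tendsto_minus[of "\<lambda>n. s n - t n" 0 sequentially] by (auto simp: cauchy_equiv_def)
  qed
  show "transp (cauchy_equiv :: (nat \<Rightarrow> 'a) \<Rightarrow> _)"
  proof (rule transpI)
    fix s t r :: "nat \<Rightarrow> 'a" assume "cauchy_equiv s t" "cauchy_equiv t r"
    then show "cauchy_equiv s r"
      using tendsto_add[of "\<lambda>n. s n - t n" 0 sequentially "\<lambda>n. t n - r n" 0]
      by (auto simp: cauchy_equiv_def)
  qed
qed

quotient_type (overloaded) 'a completion =
  "nat \<Rightarrow> 'a::real_normed_vector" / partial: cauchy_equiv
  by (rule cauchy_equiv_part)

lemma cauchy_norm_convergent: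
  fixes s :: "nat \<Rightarrow> 'a::real_normed_vector"
  assumes "Cauchy s" shows "convergent (\<lambda>n. norm (s n))"
proof -
  have "Cauchy (\<lambda>n. norm (s n))"
    unfolding Cauchy_iff
  proof (intro allI impI)
    fix e :: real assume "0 < e"
    then obtain M where M: "\<forall>m\<ge>M. \<forall>n\<ge>M. norm (s m - s n) < e"
      using assms by (auto simp: Cauchy_iff)
    then show "\<exists>M. \<forall>m\<ge>M. \<forall>n\<ge>M. norm (norm (s m) - norm (s n)) < e"
      by (smt (verit) norm_triangle_ineq3 real_norm_def)
  qed
  then show ?thesis by (simp add: Cauchy_convergent)
qed

lemma cauchy_add: "Cauchy s \<Longrightarrow> Cauchy t \<Longrightarrow> Cauchy (\<lambda>n. s n + t n :: 'a::real_normed_vector)"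
  unfolding Cauchy_iff
proof (intro allI impI)
  fix e :: real
  assume st: "\<forall>e>0. \<exists>M. \<forall>m\<ge>M. \<forall>n\<ge>M. norm (s m - s n) < e"
    "\<forall>e>0. \<exists>M. \<forall>m\<ge>M. \<forall>n\<ge>M. norm (t m - t n) < e" and e: "0 < e"
  obtain M where M: "\<forall>m\<ge>M. \<forall>n\<ge>M. norm (s m - s n) < e/2" using st(1) e half_gt_zero by blast
  obtain N where N: "\<forall>m\<ge>N. \<forall>n\<ge>N. norm (t m - t n) < e/2" using st(2) e half_gt_zero by blast
  show "\<exists>M. \<forall>m\<ge>M. \<forall>n\<ge>M. norm (s m + t m - (s n + t n)) < e"
  proof (intro exI[of _ "max M N"] allI impI)
    fix m n assume mn: "max M N \<le> m" "max M N \<le> n"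
    have "norm (s m + t m - (s n + t n)) \<le> norm (s m - s n) + norm (t m - t n)"
      by (metis add_diff_add norm_triangle_ineq)
    also have "\<dots> < e/2 + e/2" using M N mn by (intro add_strict_mono) auto
    finally show "norm (s m + t m - (s n + t n)) < e" by simp
  qed
qed

lemma cauchy_scaleR: "Cauchy s \<Longrightarrow> Cauchy (\<lambda>n. c *\<^sub>R s n :: 'a::real_normed_vector)"
  by (rule bounded_linear.Cauchy[OF bounded_linear_scaleR_right])

lemma cauchy_minus: "Cauchy s \<Longrightarrow> Cauchy (\<lambda>n. - s n :: 'a::real_normed_vector)"
  by (rule bounded_linear.Cauchy[OF bounded_linear_minus[OF bounded_linear_ident]])

lemma cauchy_diff: "Cauchy s \<Longrightarrow> Cauchy t \<Longrightarrow> Cauchy (\<lambda>n. s n - t n :: 'a::real_normed_vector)"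
  using cauchy_add[OF _ cauchy_minus, of s t] by simp

lemma cauchy_const: "Cauchy (\<lambda>_. c :: 'a::real_normed_vector)"
  by (simp add: convergent_Cauchy convergent_const)

instantiation completion :: (real_normed_vector) real_vector
begin

lift_definition zero_completion :: "'a completion" is "\<lambda>_. 0"
  by (simp add: cauchy_equiv_def cauchy_const)

lift_definition plus_completion :: "'a completion \<Rightarrow> 'a completion \<Rightarrow> 'a completion"
  is "\<lambda>s t n. s n + t n"
proof -
  fix s t s' t' :: "nat \<Rightarrow> 'a" assume a: "cauchy_equiv s t" "cauchy_equiv s' t'"
  then have "(\<lambda>n. (s n - t n) + (s' n - t' n)) \<longlonglongrightarrow> 0 + 0"
    by (intro tendsto_add) (auto simp: cauchy_equiv_def)
  with a show "cauchy_equiv (\<lambda>n. s n + s' n) (\<lambda>n. t n + t' n)"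
    by (auto simp: cauchy_equiv_def cauchy_add algebra_simps)
qed

lift_definition uminus_completion :: "'a completion \<Rightarrow> 'a completion" is "\<lambda>s n. - s n"
proof -
  fix s t :: "nat \<Rightarrow> 'a" assume a: "cauchy_equiv s t"
  then have "(\<lambda>n. - (s n - t n)) \<longlonglongrightarrow> - 0"
    by (intro tendsto_minus) (auto simp: cauchy_equiv_def)
  with a show "cauchy_equiv (\<lambda>n. - s n) (\<lambda>n. - t n)"
    by (auto simp: cauchy_equiv_def cauchy_minus)
qed

definition minus_completion :: "'a completion \<Rightarrow> 'a completion \<Rightarrow> 'a completion" where
  "minus_completion a b = a + - b"

lift_definition scaleR_completion :: "real \<Rightarrow> 'a completion \<Rightarrow> 'a completion"
  is "\<lambda>c s n. c *\<^sub>R s n"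
proof -
  fix c :: real and s t :: "nat \<Rightarrow> 'a" assume a: "cauchy_equiv s t"
  then have "(\<lambda>n. c *\<^sub>R (s n - t n)) \<longlonglongrightarrow> c *\<^sub>R 0"
    by (intro tendsto_scaleR tendsto_const) (auto simp: cauchy_equiv_def)
  with a show "cauchy_equiv (\<lambda>n. c *\<^sub>R s n) (\<lambda>n. c *\<^sub>R t n)"
    by (auto simp: cauchy_equiv_def cauchy_scaleR algebra_simps)
qed

instance
proof
  fix a b c :: "'a completion" and r q :: real
  show "a + b + c = a + (b + c)"
    by transfer (auto simp: cauchy_equiv_def add.assoc intro!: cauchy_add)
  show "a + b = b + a"
    by transfer (auto simp: cauchy_equiv_def add.commute intro!: cauchy_add)
  show "0 + a = a" by transfer (auto simp: cauchy_equiv_def)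
  show "- a + a = 0" by transfer (auto simp: cauchy_equiv_def cauchy_const)
  show "a - b = a + - b" by (simp add: minus_completion_def)
  show "r *\<^sub>R (a + b) = r *\<^sub>R a + r *\<^sub>R b"
    by transfer (auto simp: cauchy_equiv_def scaleR_add_right intro!: cauchy_add cauchy_scaleR)
  show "(r + q) *\<^sub>R a = r *\<^sub>R a + q *\<^sub>R a"
    by transfer (auto simp: cauchy_equiv_def scaleR_add_left intro!: cauchy_add cauchy_scaleR)
  show "r *\<^sub>R q *\<^sub>R a = (r * q) *\<^sub>R a"
    by transfer (auto simp: cauchy_equiv_def intro!: cauchy_scaleR)
  show "1 *\<^sub>R a = a" by transfer (auto simp: cauchy_equiv_def)
qed

end

instantiation completion :: (real_normed_vector) real_normed_vector
begin

lift_definition norm_completion :: "'a completion \<Rightarrow> real" is "\<lambda>s. lim (\<lambda>n. norm (s n))"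
proof -
  fix s t :: "nat \<Rightarrow> 'a" assume a: "cauchy_equiv s t"
  then have "(\<lambda>n. norm (s n - t n)) \<longlonglongrightarrow> 0"
    by (auto simp: cauchy_equiv_def intro: tendsto_norm_zero)
  moreover have "\<bar>norm (s n) - norm (t n)\<bar> \<le> norm (s n - t n)" for n
    by (rule norm_triangle_ineq3)
  ultimately have "(\<lambda>n. norm (s n) - norm (t n)) \<longlonglongrightarrow> 0"
    by (intro Lim_null_comparison[of "\<lambda>n. norm (s n) - norm (t n)"]) auto
  moreover have "(\<lambda>n. norm (t n)) \<longlonglongrightarrow> lim (\<lambda>n. norm (t n))"
    using a cauchy_norm_convergent[of t] by (simp add: cauchy_equiv_def convergent_LIMSEQ_iff)
  ultimately have "(\<lambda>n. norm (s n)) \<longlonglongrightarrow> lim (\<lambda>n. norm (t n))"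
    by (rule Lim_transform[rotated])
  then show "lim (\<lambda>n. norm (s n)) = lim (\<lambda>n. norm (t n))" by (rule limI)
qed

definition dist_completion :: "'a completion \<Rightarrow> 'a completion \<Rightarrow> real" where
  "dist_completion a b = norm (a - b)"
definition sgn_completion :: "'a completion \<Rightarrow> 'a completion" where
  "sgn_completion a = a /\<^sub>R norm a"
definition uniformity_completion :: "('a completion \<times> 'a completion) filter" where
  "uniformity_completion = (INF e\<in>{0<..}. principal {(x, y). dist x y < e})"
definition open_completion :: "'a completion set \<Rightarrow> bool" where
  "open_completion U \<longleftrightarrow> (\<forall>x\<in>U. eventually (\<lambda>(x', y). x' = x \<longrightarrow> y \<in> U) uniformity)"

instance
proof
  fix a b :: "'a completion" and r :: real
  show "dist a b = norm (a - b)" by (simp add: dist_completion_def)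
  show "sgn a = a /\<^sub>R norm a" by (simp add: sgn_completion_def)
  show "uniformity = (INF e\<in>{0<..}. principal {(x::'a completion, y). dist x y < e})"
    by (simp add: uniformity_completion_def)
  show "open U \<longleftrightarrow> (\<forall>x\<in>U. eventually (\<lambda>(x', y). x' = x \<longrightarrow> y \<in> U) uniformity)"
    for U :: "'a completion set" by (simp add: open_completion_def)
  show "norm a = 0 \<longleftrightarrow> a = 0"
  proof transfer
    fix s :: "nat \<Rightarrow> 'a" assume "cauchy_equiv s s"
    then have s: "Cauchy s" by (simp add: cauchy_equiv_def)
    then have "(\<lambda>n. norm (s n)) \<longlonglongrightarrow> lim (\<lambda>n. norm (s n))"
      by (metis cauchy_norm_convergent convergent_LIMSEQ_iff)
    then have "lim (\<lambda>n. norm (s n)) = 0 \<longleftrightarrow> (\<lambda>n. norm (s n)) \<longlonglongrightarrow> 0"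
      using LIMSEQ_unique by fastforce
    then show "lim (\<lambda>n. norm (s n)) = 0 \<longleftrightarrow> cauchy_equiv s (\<lambda>_. 0)"
      using s by (simp add: cauchy_equiv_def cauchy_const tendsto_norm_zero_iff)
  qed
  show "norm (a + b) \<le> norm a + norm b"
  proof transfer
    fix s t :: "nat \<Rightarrow> 'a" assume "cauchy_equiv s s" "cauchy_equiv t t"
    then have st: "Cauchy s" "Cauchy t" by (simp_all add: cauchy_equiv_def)
    have "(\<lambda>n. norm (s n)) \<longlonglongrightarrow> lim (\<lambda>n. norm (s n))" "(\<lambda>n. norm (t n)) \<longlonglongrightarrow> lim (\<lambda>n. norm (t n))"
      "(\<lambda>n. norm (s n + t n)) \<longlonglongrightarrow> lim (\<lambda>n. norm (s n + t n))"
      using st cauchy_add[OF st] by (metis cauchy_norm_convergent convergent_LIMSEQ_iff)+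
    then show "lim (\<lambda>n. norm (s n + t n)) \<le> lim (\<lambda>n. norm (s n)) + lim (\<lambda>n. norm (t n))"
      by (intro LIMSEQ_le[OF _ tendsto_add]) (auto intro: norm_triangle_ineq)
  qed
  show "norm (r *\<^sub>R a) = \<bar>r\<bar> * norm a"
  proof transfer
    fix r :: real and s :: "nat \<Rightarrow> 'a" assume "cauchy_equiv s s"
    then have "Cauchy s" by (simp add: cauchy_equiv_def)
    then have "(\<lambda>n. norm (s n)) \<longlonglongrightarrow> lim (\<lambda>n. norm (s n))"
      by (metis cauchy_norm_convergent convergent_LIMSEQ_iff)
    then have "(\<lambda>n. norm (r *\<^sub>R s n)) \<longlonglongrightarrow> \<bar>r\<bar> * lim (\<lambda>n. norm (s n))"
      by (auto intro!: tendsto_intros)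
    then show "lim (\<lambda>n. norm (r *\<^sub>R s n)) = \<bar>r\<bar> * lim (\<lambda>n. norm (s n))" by (rule limI)
  qed
qed

end

lift_definition to_completion :: "'a::real_normed_vector \<Rightarrow> 'a completion" is "\<lambda>x _. x"
  by (simp add: cauchy_equiv_def cauchy_const)

lemma norm_to_completion [simp]: "norm (to_completion x) = norm x"
  by transfer simp

lemma linear_to_completion: "linear to_completion"
proof
  show "to_completion (x + y) = to_completion x + to_completion y" for x y :: 'a
    by transfer (auto simp: cauchy_equiv_def cauchy_const)
  show "to_completion (r *\<^sub>R x) = r *\<^sub>R to_completion x" for r and x :: 'a
    by transfer (auto simp: cauchy_equiv_def cauchy_const)
qed

lemma completion_limit:
  assumes "Cauchy s"
  shows "(\<lambda>n. to_completion (s n)) \<longlonglongrightarrow> abs_completion s"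
proof (rule LIMSEQ_I)
  fix e :: real assume e: "0 < e"
  then obtain M where M: "\<And>m n. m \<ge> M \<Longrightarrow> n \<ge> M \<Longrightarrow> norm (s m - s n) < e/2"
    using assms unfolding Cauchy_iff by (meson half_gt_zero)
  have ss: "cauchy_equiv s s" using assms by (simp add: cauchy_equiv_def)
  show "\<exists>M. \<forall>n\<ge>M. norm (to_completion (s n) - abs_completion s) < e"
  proof (intro exI[of _ M] allI impI)
    fix n assume n: "n \<ge> M"
    have d: "Cauchy (\<lambda>m. s n + - s m)" using assms by (intro cauchy_add cauchy_const cauchy_minus)
    have cc: "cauchy_equiv (\<lambda>_. s n) (\<lambda>_. s n)" by (simp add: cauchy_equiv_def cauchy_const)
    have mm: "cauchy_equiv (\<lambda>m. - s m) (\<lambda>m. - s m)"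
      using assms by (simp add: cauchy_equiv_def cauchy_minus)
    have dd: "cauchy_equiv (\<lambda>m. s n + - s m) (\<lambda>m. s n + - s m)"
      using d by (simp add: cauchy_equiv_def)
    have "to_completion (s n) - abs_completion s = abs_completion (\<lambda>m. s n + - s m)"
      by (simp only: minus_completion_def to_completion.abs_eq uminus_completion.abs_eq[OF ss]
          plus_completion.abs_eq[OF cc mm])
    then have "norm (to_completion (s n) - abs_completion s) = lim (\<lambda>m. norm (s n + - s m))"
      using norm_completion.abs_eq[OF dd] by simp
    moreover have "(\<lambda>m. norm (s n + - s m)) \<longlonglongrightarrow> lim (\<lambda>m. norm (s n + - s m))"
      using cauchy_norm_convergent[OF d] by (simp add: convergent_LIMSEQ_iff)
    then have "lim (\<lambda>m. norm (s n + - s m)) \<le> e/2"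
    proof (rule LIMSEQ_le_const2)
      show "\<exists>N. \<forall>m\<ge>N. norm (s n + - s m) \<le> e/2"
        using M n by (metis add_uminus_conv_diff less_imp_le)
    qed
    ultimately show "norm (to_completion (s n) - abs_completion s) < e" using e by simp
  qed
qed

lemma dense_to_completion: "closure (range to_completion) = UNIV"
proof -
  have "a \<in> closure (range to_completion)" for a :: "'a completion"
  proof -
    obtain s where s: "cauchy_equiv s s" "a = abs_completion s"
      using that[of "rep_completion a"] Quotient_rep_reflp[OF Quotient_completion, of a]
        Quotient_abs_rep[OF Quotient_completion, of a] by simp
    then have "(\<lambda>n. to_completion (s n)) \<longlonglongrightarrow> a"
      using completion_limit by (auto simp: cauchy_equiv_def)
    then show ?thesis
      by (intro closure_sequential[THEN iffD2] exI[of _ "\<lambda>n. to_completion (s n)"]) simp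
  qed
  then show ?thesis by blast
qed

instance completion :: (real_normed_vector) banach
proof
  fix X :: "nat \<Rightarrow> 'a completion" assume X: "Cauchy X"
  have "\<exists>x. dist (to_completion x) (X n) < inverse (real (Suc n))" for n
  proof -
    have "X n \<in> closure (range to_completion)" by (simp add: dense_to_completion)
    then have "\<exists>y\<in>range to_completion. dist y (X n) < inverse (real (Suc n))"
      unfolding closure_approachable by auto
    then show ?thesis by auto
  qed
  then obtain s where s: "\<And>n. dist (to_completion (s n)) (X n) < inverse (real (Suc n))"
    by metis
  have lim0: "(\<lambda>n. to_completion (s n) - X n) \<longlonglongrightarrow> 0"
    by (rule Lim_null_comparison[OF _ LIMSEQ_inverse_real_of_nat])
      (use s in \<open>simp add: dist_norm less_imp_le\<close>)
  then have "Cauchy (\<lambda>n. to_completion (s n) - X n)"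
    by (meson LIMSEQ_imp_Cauchy)
  from cauchy_add[OF this X] have "Cauchy (\<lambda>n. to_completion (s n))" by simp
  then have "Cauchy s"
    by (simp add: Cauchy_iff flip: linear_diff[OF linear_to_completion])
  from tendsto_diff[OF completion_limit[OF this] lim0]
  have "X \<longlonglongrightarrow> abs_completion s" by simp
  then show "convergent X" by (auto simp: convergent_def)
qed

section \<open>Lipschitz maps and the Lipschitz-free space\<close>

definition Lip0 :: "('a::{metric_space,zero} \<Rightarrow> 'b::real_normed_vector) set" where
  "Lip0 = {f. f 0 = 0 \<and> (\<exists>L. L-lipschitz_on UNIV f)}"

typedef (overloaded) ('a::"{metric_space,zero}", 'b::real_normed_vector) lip0
  = "Lip0 :: ('a \<Rightarrow> 'b) set"
  morphisms lip_app Lip_Abs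
proof
  show "(\<lambda>_. 0) \<in> Lip0" by (auto simp: Lip0_def lipschitz_on_def)
qed

definition delta :: "'a::{metric_space,zero} \<Rightarrow> 'a \<Rightarrow> ('a, real) lip0 rfun" where
  "delta x y = RFun (\<lambda>f. lip_app f x - lip_app f y)"

typedef (overloaded) ('a::"{metric_space,zero}") molecule
  = "span {delta x y | x y. True} :: ('a, real) lip0 rfun set"
  morphisms mol_rep Molecule
  using span_zero by blast

setup_lifting type_definition_molecule

lift_definition mdelta :: "'a::{metric_space,zero} \<Rightarrow> 'a \<Rightarrow> 'a molecule" is delta
  by (auto intro: span_base)

lemma lip_on_dist:
  assumes "L-lipschitz_on UNIV (g :: 'a::metric_space \<Rightarrow> real)"
  shows "\<bar>g x - g y\<bar> \<le> L * dist x y"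
  using assms by (auto simp: lipschitz_on_def dist_real_def)

lemma lip_app_lipschitz: obtains L where "L-lipschitz_on UNIV (lip_app f)"
  using lip_app[of f] by (auto simp: Lip0_def)

instantiation molecule :: ("{metric_space,zero}") real_vector
begin
lift_definition zero_molecule :: "'a molecule" is 0 by (rule span_zero)
lift_definition plus_molecule :: "'a molecule \<Rightarrow> 'a molecule \<Rightarrow> 'a molecule" is "(+)"
  by (rule span_add)
lift_definition minus_molecule :: "'a molecule \<Rightarrow> 'a molecule \<Rightarrow> 'a molecule" is "(-)"
  by (rule span_diff)
lift_definition uminus_molecule :: "'a molecule \<Rightarrow> 'a molecule" is uminus
  by (rule span_neg)
lift_definition scaleR_molecule :: "real \<Rightarrow> 'a molecule \<Rightarrow> 'a molecule" is scaleR
  by (rule span_scale)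
instance by standard (transfer; simp add: scaleR_add_right scaleR_add_left)+
end

lemma mol_rep_sum: "mol_rep (\<Sum>i\<in>I. m i) = (\<Sum>i\<in>I. mol_rep (m i))"
  by (induction I rule: infinite_finite_induct)
     (auto simp: zero_molecule.rep_eq plus_molecule.rep_eq)

lemma span_sum_form:
  assumes "u \<in> span {h a b | a b. True}"
  shows "\<exists>n l x y. u = (\<Sum>i<n::nat. l i *\<^sub>R h (x i) (y i))"
  using assms
proof (induction rule: span_induct_alt)
  case base
  show ?case by (rule exI[of _ 0]) simp
next
  case (step c z u)
  then obtain n l x y where u: "u = (\<Sum>i<n::nat. l i *\<^sub>R h (x i) (y i))" by blast
  from step obtain a b where z: "z = h a b" by blast
  have "(\<Sum>i<n. (l(n := c)) i *\<^sub>R h ((x(n := a)) i) ((y(n := b)) i)) = u"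
    unfolding u by (rule sum.cong) auto
  then have "c *\<^sub>R z + u = (\<Sum>i<Suc n. (l(n := c)) i *\<^sub>R h ((x(n := a)) i) ((y(n := b)) i))"
    by (simp add: z add.commute)
  then show ?case by blast
qed

lemma molecule_sum_form:
  "\<exists>n l x y. m = (\<Sum>i<n::nat. l i *\<^sub>R mdelta (x i) (y i))"
proof -
  obtain n l x y where "mol_rep m = (\<Sum>i<n::nat. l i *\<^sub>R delta (x i) (y i))"
    using span_sum_form[OF mol_rep[of m]] by blast
  also have "\<dots> = mol_rep (\<Sum>i<n. l i *\<^sub>R mdelta (x i) (y i))"
    by (simp add: mol_rep_sum scaleR_molecule.rep_eq mdelta.rep_eq)
  finally show ?thesis by (auto simp: mol_rep_inject)
qed

definition molecule_costs :: "'a::{metric_space,zero} molecule \<Rightarrow> real set" where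
  "molecule_costs m = {\<Sum>i<n. \<bar>l i\<bar> * dist (x i) (y i) | (n::nat) l x y.
     m = (\<Sum>i<n. l i *\<^sub>R mdelta (x i) (y i))}"

lemma molecule_costs_nonempty: "molecule_costs m \<noteq> {}"
  using molecule_sum_form[of m] by (force simp: molecule_costs_def)

lemma molecule_costs_nonneg: "r \<in> molecule_costs m \<Longrightarrow> 0 \<le> r"
  by (auto simp: molecule_costs_def intro!: sum_nonneg)

lemma molecule_costs_bdd: "bdd_below (molecule_costs m)"
  by (meson bdd_belowI molecule_costs_nonneg)

lemma molecule_costs_add:
  assumes "r \<in> molecule_costs m" "q \<in> molecule_costs k"
  shows "r + q \<in> molecule_costs (m + k)"
proof -
  obtain n l x y where m: "m = (\<Sum>i<n::nat. l i *\<^sub>R mdelta (x i) (y i))"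
    and r: "r = (\<Sum>i<n. \<bar>l i\<bar> * dist (x i) (y i))"
    using assms(1) by (auto simp: molecule_costs_def)
  obtain n' l' x' y' where k: "k = (\<Sum>i<n'::nat. l' i *\<^sub>R mdelta (x' i) (y' i))"
    and q: "q = (\<Sum>i<n'. \<bar>l' i\<bar> * dist (x' i) (y' i))"
    using assms(2) by (auto simp: molecule_costs_def)
  define L X Y where "L i = (if i < n then l i else l' (i - n))"
    and "X i = (if i < n then x i else x' (i - n))"
    and "Y i = (if i < n then y i else y' (i - n))" for i
  have "m + k = (\<Sum>i<n+n'. L i *\<^sub>R mdelta (X i) (Y i))"
    unfolding sum_lessThan_add m k by (simp add: L_def X_def Y_def)
  moreover have "r + q = (\<Sum>i<n+n'. \<bar>L i\<bar> * dist (X i) (Y i))"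
    unfolding sum_lessThan_add r q by (simp add: L_def X_def Y_def)
  ultimately show ?thesis unfolding molecule_costs_def by blast
qed

lemma molecule_costs_scaleR:
  assumes "r \<in> molecule_costs m"
  shows "\<bar>c\<bar> * r \<in> molecule_costs (c *\<^sub>R m)"
proof -
  obtain n l x y where m: "m = (\<Sum>i<n::nat. l i *\<^sub>R mdelta (x i) (y i))"
    and r: "r = (\<Sum>i<n. \<bar>l i\<bar> * dist (x i) (y i))"
    using assms by (auto simp: molecule_costs_def)
  have "c *\<^sub>R m = (\<Sum>i<n. (c * l i) *\<^sub>R mdelta (x i) (y i))"
    by (simp add: m scaleR_sum_right)
  moreover have "\<bar>c\<bar> * r = (\<Sum>i<n. \<bar>c * l i\<bar> * dist (x i) (y i))"
    by (simp add: r sum_distrib_left abs_mult mult.assoc)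
  ultimately show ?thesis unfolding molecule_costs_def
    by (intro CollectI exI[of _ n] exI[of _ "\<lambda>i. c * l i"] exI[of _ x] exI[of _ y]) auto
qed

lemma molecule_costs_bound:
  assumes "L-lipschitz_on UNIV (lip_app f)" "r \<in> molecule_costs m"
  shows "\<bar>rapp (mol_rep m) f\<bar> \<le> L * r"
proof -
  obtain n l x y where m: "m = (\<Sum>i<n::nat. l i *\<^sub>R mdelta (x i) (y i))"
    and r: "r = (\<Sum>i<n. \<bar>l i\<bar> * dist (x i) (y i))"
    using assms(2) by (auto simp: molecule_costs_def)
  have "\<bar>rapp (mol_rep m) f\<bar> = \<bar>\<Sum>i<n. l i * (lip_app f (x i) - lip_app f (y i))\<bar>"
    by (simp add: m mol_rep_sum scaleR_molecule.rep_eq mdelta.rep_eq delta_def)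
  also have "\<dots> \<le> (\<Sum>i<n. \<bar>l i\<bar> * (L * dist (x i) (y i)))"
    by (rule order_trans[OF sum_abs])
       (auto simp: abs_mult intro!: sum_mono mult_left_mono lip_on_dist[OF assms(1)])
  also have "\<dots> = L * r" by (simp add: r sum_distrib_left mult.left_commute)
  finally show ?thesis .
qed

instantiation molecule :: ("{metric_space,zero}") real_normed_vector
begin

definition norm_molecule :: "'a molecule \<Rightarrow> real" where
  "norm_molecule m = Inf (molecule_costs m)"
definition dist_molecule :: "'a molecule \<Rightarrow> 'a molecule \<Rightarrow> real" where
  "dist_molecule a b = norm (a - b)"
definition sgn_molecule :: "'a molecule \<Rightarrow> 'a molecule" where
  "sgn_molecule a = a /\<^sub>R norm a"
definition uniformity_molecule :: "('a molecule \<times> 'a molecule) filter" where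
  "uniformity_molecule = (INF e\<in>{0<..}. principal {(x, y). dist x y < e})"
definition open_molecule :: "'a molecule set \<Rightarrow> bool" where
  "open_molecule U \<longleftrightarrow> (\<forall>x\<in>U. eventually (\<lambda>(x', y). x' = x \<longrightarrow> y \<in> U) uniformity)"

instance
proof
  fix a b :: "'a molecule" and c :: real
  show "dist a b = norm (a - b)" by (simp add: dist_molecule_def)
  show "sgn a = a /\<^sub>R norm a" by (simp add: sgn_molecule_def)
  show "uniformity = (INF e\<in>{0<..}. principal {(x::'a molecule, y). dist x y < e})"
    by (simp add: uniformity_molecule_def)
  show "open U \<longleftrightarrow> (\<forall>x\<in>U. eventually (\<lambda>(x', y). x' = x \<longrightarrow> y \<in> U) uniformity)"
    for U :: "'a molecule set" by (simp add: open_molecule_def)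
  have zero: "norm (0::'a molecule) = 0"
  proof -
    have "0 \<in> molecule_costs (0::'a molecule)"
      unfolding molecule_costs_def by (rule CollectI, rule exI[of _ 0]) simp
    then show ?thesis unfolding norm_molecule_def
      by (intro antisym cInf_lower molecule_costs_bdd cInf_greatest)
         (auto dest: molecule_costs_nonneg)
  qed
  show "norm a = 0 \<longleftrightarrow> a = 0"
  proof
    assume a: "norm a = 0"
    have "rapp (mol_rep a) f = 0" for f
    proof -
      obtain L where L: "L-lipschitz_on UNIV (lip_app f)" by (rule lip_app_lipschitz)
      then have L0: "0 \<le> L" by (simp add: lipschitz_on_def)
      have "\<bar>rapp (mol_rep a) f\<bar> \<le> e" if e: "0 < e" for e
      proof -
        have "Inf (molecule_costs a) < e / (L + 1)"
          using a e L0 by (simp add: norm_molecule_def)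
        then obtain r where r: "r \<in> molecule_costs a" "r < e / (L + 1)"
          using cInf_lessD[OF molecule_costs_nonempty] by blast
        have "\<bar>rapp (mol_rep a) f\<bar> \<le> L * r" by (rule molecule_costs_bound[OF L r(1)])
        also have "\<dots> \<le> (L + 1) * r"
          using molecule_costs_nonneg[OF r(1)] by (simp add: algebra_simps)
        also have "\<dots> \<le> e" using r(2) L0 by (simp add: field_simps)
        finally show ?thesis .
      qed
      then have "\<bar>rapp (mol_rep a) f\<bar> \<le> 0" by (metis field_le_epsilon add_0)
      then show ?thesis by simp
    qed
    then have "mol_rep a = 0" by (intro rfun_eqI) simp
    then show "a = 0" by (metis mol_rep_inject zero_molecule.rep_eq)
  qed (simp add: zero)
  show "norm (a + b) \<le> norm a + norm b"
  proof (rule field_le_epsilon)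
    fix e :: real assume e: "0 < e"
    obtain r where r: "r \<in> molecule_costs a" "r < norm a + e/2"
      using cInf_lessD[OF molecule_costs_nonempty, of a "norm a + e/2"] e
      by (auto simp: norm_molecule_def)
    obtain q where q: "q \<in> molecule_costs b" "q < norm b + e/2"
      using cInf_lessD[OF molecule_costs_nonempty, of b "norm b + e/2"] e
      by (auto simp: norm_molecule_def)
    have "norm (a + b) \<le> r + q" unfolding norm_molecule_def
      by (intro cInf_lower molecule_costs_bdd molecule_costs_add r q)
    with r q show "norm (a + b) \<le> norm a + norm b + e" by simp
  qed
  have scale_le: "norm (c *\<^sub>R a) \<le> \<bar>c\<bar> * norm a" if "c \<noteq> 0" for c and a :: "'a molecule"
  proof -
    have "norm (c *\<^sub>R a) / \<bar>c\<bar> \<le> Inf (molecule_costs a)"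
    proof (rule cInf_greatest[OF molecule_costs_nonempty])
      fix r assume "r \<in> molecule_costs a"
      then have "norm (c *\<^sub>R a) \<le> \<bar>c\<bar> * r" unfolding norm_molecule_def
        by (intro cInf_lower molecule_costs_bdd molecule_costs_scaleR)
      then show "norm (c *\<^sub>R a) / \<bar>c\<bar> \<le> r" using that by (simp add: field_simps)
    qed
    then show ?thesis using that by (simp add: norm_molecule_def field_simps)
  qed
  show "norm (c *\<^sub>R a) = \<bar>c\<bar> * norm a"
  proof (cases "c = 0")
    case False
    have "norm a = norm (inverse c *\<^sub>R c *\<^sub>R a)" using False by simp
    also have "\<dots> \<le> \<bar>inverse c\<bar> * norm (c *\<^sub>R a)" using False by (intro scale_le) simp
    finally have "\<bar>c\<bar> * norm a \<le> norm (c *\<^sub>R a)" using False by (simp add: field_simps)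
    with scale_le[OF False, of a] show ?thesis by simp
  qed (simp add: zero)
qed

end

type_synonym 'a free_space = "'a molecule completion"

definition fdelta :: "'a::{metric_space,zero} \<Rightarrow> 'a \<Rightarrow> 'a free_space" where
  "fdelta x y = to_completion (mdelta x y)"

section \<open>Algebraic tensor products\<close>

typedef (overloaded) ('f::real_vector, 'g::real_vector) bilinear_form
  = "{B :: 'f \<Rightarrow> 'g \<Rightarrow> real. bilinear B}"
  morphisms bil_app Bil_Abs
  by (rule exI[of _ "\<lambda>_ _. 0"]) (auto simp: bilinear_def linear_iff)

definition etensor :: "'f::real_vector \<Rightarrow> 'g::real_vector \<Rightarrow> ('f, 'g) bilinear_form rfun" where
  "etensor x g = RFun (\<lambda>B. bil_app B x g)"

text \<open>\<open>F \<otimes> G\<close> is realised inside the algebraic dual of the bilinear forms on \<open>F \<times> G\<close>, with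
  \<open>x \<otimes> g\<close> acting as evaluation at \<open>(x, g)\<close>.\<close>

typedef (overloaded) ('f::real_vector, 'g::real_vector) tensor
  = "span {etensor x g | x g. True} :: ('f, 'g) bilinear_form rfun set"
  morphisms tensor_rep Tensor
  using span_zero by blast

setup_lifting type_definition_tensor

lift_definition tensor_pair :: "'f::real_vector \<Rightarrow> 'g::real_vector \<Rightarrow> ('f, 'g) tensor"
  (infixl \<open>\<otimes>\<^sub>t\<close> 76) is etensor
  by (auto intro: span_base)

instantiation tensor :: (real_vector, real_vector) real_vector
begin
lift_definition zero_tensor :: "('a, 'b) tensor" is 0 by (rule span_zero)
lift_definition plus_tensor :: "('a, 'b) tensor \<Rightarrow> ('a, 'b) tensor \<Rightarrow> ('a, 'b) tensor" is "(+)"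
  by (rule span_add)
lift_definition minus_tensor :: "('a, 'b) tensor \<Rightarrow> ('a, 'b) tensor \<Rightarrow> ('a, 'b) tensor" is "(-)"
  by (rule span_diff)
lift_definition uminus_tensor :: "('a, 'b) tensor \<Rightarrow> ('a, 'b) tensor" is uminus
  by (rule span_neg)
lift_definition scaleR_tensor :: "real \<Rightarrow> ('a, 'b) tensor \<Rightarrow> ('a, 'b) tensor" is scaleR
  by (rule span_scale)
instance by standard (transfer; simp add: scaleR_add_right scaleR_add_left)+
end

lemma tensor_rep_sum: "tensor_rep (\<Sum>i\<in>I. m i) = (\<Sum>i\<in>I. tensor_rep (m i))"
  by (induction I rule: infinite_finite_induct)
     (auto simp: zero_tensor.rep_eq plus_tensor.rep_eq)

lemma bilinear_bil_app: "bilinear (bil_app B)"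
  using bil_app[of B] by simp

lemma tensor_eq_iff:
  "u = v \<longleftrightarrow> (\<forall>B. rapp (tensor_rep u) B = rapp (tensor_rep v) B)"
  by (metis rfun_eqI tensor_rep_inject)

lemma rapp_tensor_pair [simp]: "rapp (tensor_rep (x \<otimes>\<^sub>t g)) B = bil_app B x g"
  by (simp add: tensor_pair.rep_eq etensor_def)

lemma bilinear_tensor_pair: "bilinear (\<otimes>\<^sub>t)"
  using bilinear_bil_app
  by (auto simp: bilinear_def linear_iff tensor_eq_iff plus_tensor.rep_eq scaleR_tensor.rep_eq)

lemma tensor_sum_form: "\<exists>n x g. u = (\<Sum>i<n::nat. x i \<otimes>\<^sub>t g i)"
proof -
  obtain n l x y where "tensor_rep u = (\<Sum>i<n::nat. l i *\<^sub>R etensor (x i) (y i))"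
    using span_sum_form[OF tensor_rep[of u]] by blast
  also have "\<dots> = tensor_rep (\<Sum>i<n. (l i *\<^sub>R x i) \<otimes>\<^sub>t y i)"
    by (rule rfun_eqI)
       (simp add: tensor_rep_sum etensor_def bilinear_lmul[OF bilinear_bil_app])
  finally have "u = (\<Sum>i<n. (l i *\<^sub>R x i) \<otimes>\<^sub>t y i)" by (simp only: tensor_rep_inject)
  then show ?thesis by (intro exI)
qed

section \<open>Summing operators\<close>

definition conj_exponent :: "real \<Rightarrow> ereal" where
  "conj_exponent p = (if p = 1 then \<infinity> else ereal (p / (p - 1)))"

definition lp_norm :: "ereal \<Rightarrow> nat \<Rightarrow> (nat \<Rightarrow> 'g::real_normed_vector) \<Rightarrow> real" where
  "lp_norm q n g =
     (if q = \<infinity> then Max (insert 0 ((\<lambda>i. norm (g i)) ` {..<n}))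
      else (\<Sum>i<n. norm (g i) powr real_of_ereal q) powr (1 / real_of_ereal q))"

definition weak_lp_norm :: "real \<Rightarrow> nat \<Rightarrow> (nat \<Rightarrow> 'f::real_normed_vector) \<Rightarrow> real" where
  "weak_lp_norm p n x =
     (SUP \<phi>\<in>{\<phi> :: 'f \<Rightarrow>\<^sub>L real. norm \<phi> \<le> 1}. (\<Sum>i<n. \<bar>blinfun_apply \<phi> (x i)\<bar> powr p) powr (1 / p))"

definition d_p :: "real \<Rightarrow> ('f::real_normed_vector, 'g::real_normed_vector) tensor \<Rightarrow> real" where
  "d_p p u = Inf {weak_lp_norm p n x * lp_norm (conj_exponent p) n g | n x g.
     u = (\<Sum>i<n. x i \<otimes>\<^sub>t g i)}"

definition p_summing_const ::
  "real \<Rightarrow> ('f::real_normed_vector \<Rightarrow> 'g::real_normed_vector) \<Rightarrow> real \<Rightarrow> bool" where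
  "p_summing_const p S C \<longleftrightarrow> C > 0 \<and>
     (\<forall>n x (g :: nat \<Rightarrow> 'g \<Rightarrow>\<^sub>L real).
        \<bar>\<Sum>i<n. blinfun_apply (g i) (S (x i))\<bar> \<le> C * d_p p (\<Sum>i<n. x i \<otimes>\<^sub>t g i))"

definition p_summing ::
  "real \<Rightarrow> ('f::real_normed_vector \<Rightarrow> 'g::real_normed_vector) \<Rightarrow> bool" where
  "p_summing p S \<longleftrightarrow> linear S \<and> (\<exists>C. p_summing_const p S C)"

text \<open>The constants are required to be positive, so that for the zero map the least constant is
  attained only as an infimum.  The same applies to the two Lipschitz norms below.\<close>

definition p_summing_norm ::
  "real \<Rightarrow> ('f::real_normed_vector \<Rightarrow> 'g::real_normed_vector) \<Rightarrow> real" where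
  "p_summing_norm p S = Inf {C. p_summing_const p S C}"

definition lipschitz_p_summing_const ::
  "real \<Rightarrow> ('a::{metric_space,zero} \<Rightarrow> 'b::real_normed_vector) \<Rightarrow> real \<Rightarrow> bool" where
  "lipschitz_p_summing_const p T C \<longleftrightarrow> C > 0 \<and>
     (\<forall>n (x :: nat \<Rightarrow> 'a) y.
        (\<Sum>i<n. norm (T (x i) - T (y i)) powr p) \<le>
        C powr p * (SUP f\<in>{f :: 'a \<Rightarrow> real. f \<in> Lip0 \<and> 1-lipschitz_on UNIV f}.
                      \<Sum>i<n. \<bar>f (x i) - f (y i)\<bar> powr p))"

definition lipschitz_p_summing ::
  "real \<Rightarrow> ('a::{metric_space,zero} \<Rightarrow> 'b::real_normed_vector) \<Rightarrow> bool" where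
  "lipschitz_p_summing p T \<longleftrightarrow> T \<in> Lip0 \<and> (\<exists>C. lipschitz_p_summing_const p T C)"

definition lipschitz_p_summing_norm ::
  "real \<Rightarrow> ('a::{metric_space,zero} \<Rightarrow> 'b::real_normed_vector) \<Rightarrow> real" where
  "lipschitz_p_summing_norm p T = Inf {C. lipschitz_p_summing_const p T C}"

text \<open>The functional \<open>\<delta>\<^bsub>(x,y)\<^esub> \<boxtimes> e\<^sup>*\<close> on \<open>Lip\<^sub>0(X; E\<^sup>*\<^sup>*)\<close>; the space \<open>X \<boxtimes> E\<^sup>*\<close> is the set of all
  finite sums of these.\<close>

definition delta_box :: "'a::{metric_space,zero} \<Rightarrow> 'a \<Rightarrow> ('b::real_normed_vector \<Rightarrow>\<^sub>L real) \<Rightarrow>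
    ('a, ('b \<Rightarrow>\<^sub>L real) \<Rightarrow>\<^sub>L real) lip0 rfun" where
  "delta_box x y e = RFun (\<lambda>f. blinfun_apply (lip_app f x - lip_app f y) e)"

text \<open>The map \<open>\<Phi>\<close>.  Its value does not depend on the chosen representation of \<open>u\<close>: see
  \<open>box_to_tensor_sum\<close> below.\<close>

definition box_to_tensor :: "('a::{metric_space,zero}, ('b::real_normed_vector \<Rightarrow>\<^sub>L real) \<Rightarrow>\<^sub>L real) lip0 rfun
    \<Rightarrow> ('a free_space, 'b \<Rightarrow>\<^sub>L real) tensor" where
  "box_to_tensor u = (THE v. \<exists>(n::nat) x y e.
     u = (\<Sum>i<n. delta_box (x i) (y i) (e i)) \<and> v = (\<Sum>i<n. fdelta (x i) (y i) \<otimes>\<^sub>t e i))"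

lemma biorthogonal:
  fixes S :: "('b::real_normed_vector \<Rightarrow>\<^sub>L real) set"
  assumes "finite S" "independent S"
  shows "\<exists>a. \<forall>s\<in>S. \<forall>t\<in>S. blinfun_apply t (a s) = (if s = t then 1 else 0)"
  using assms
proof (induction S rule: finite_induct)
  case empty
  show ?case by simp
next
  case (insert b S)
  then have ind: "independent S" "b \<notin> span S"
    by (auto simp: independent_insert)
  then obtain a where a: "\<And>s t. s \<in> S \<Longrightarrow> t \<in> S \<Longrightarrow> blinfun_apply t (a s) = (if s = t then 1 else 0)"
    using insert.IH by blast
  define P where "P z = z - (\<Sum>s\<in>S. blinfun_apply s z *\<^sub>R a s)" for z
  have tP: "blinfun_apply t (P z) = 0" if "t \<in> S" for t z
  proof -
    have "(\<Sum>s\<in>S. blinfun_apply s z * blinfun_apply t (a s)) = (\<Sum>s\<in>S. if s = t then blinfun_apply s z else 0)"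
      using a that by (intro sum.cong) auto
    then show ?thesis
      using that insert.hyps(1)
      by (simp add: P_def blinfun.diff_right blinfun.sum_right blinfun.scaleR_right)
  qed
  have "\<exists>z. blinfun_apply b (P z) \<noteq> 0"
  proof (rule ccontr)
    assume "\<not> ?thesis"
    then have bP: "blinfun_apply b (P z) = 0" for z by blast
    have "b = (\<Sum>s\<in>S. blinfun_apply b (a s) *\<^sub>R s)"
    proof (rule blinfun_eqI)
      fix z
      have "blinfun_apply b z = (\<Sum>s\<in>S. blinfun_apply s z * blinfun_apply b (a s))"
        using bP[of z] by (simp add: P_def blinfun.diff_right blinfun.sum_right blinfun.scaleR_right)
      then show "blinfun_apply b z = blinfun_apply (\<Sum>s\<in>S. blinfun_apply b (a s) *\<^sub>R s) z"
        by (simp add: blinfun.sum_left blinfun.scaleR_left mult.commute)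
    qed
    moreover have "(\<Sum>s\<in>S. blinfun_apply b (a s) *\<^sub>R s) \<in> span S"
      by (intro span_sum span_scale span_base)
    ultimately have "b \<in> span S" by simp
    with ind show False by simp
  qed
  then obtain z where z: "blinfun_apply b (P z) \<noteq> 0" by blast
  define c where "c = P z /\<^sub>R blinfun_apply b (P z)"
  have c: "blinfun_apply b c = 1" "\<And>t. t \<in> S \<Longrightarrow> blinfun_apply t c = 0"
    using z tP by (simp_all add: c_def blinfun.scaleR_right)
  define a' where "a' s = (if s = b then c else a s - blinfun_apply b (a s) *\<^sub>R c)" for s
  have "\<forall>s\<in>insert b S. \<forall>t\<in>insert b S. blinfun_apply t (a' s) = (if s = t then 1 else 0)"
    using insert.hyps(2) a c
    by (auto simp: a'_def blinfun.diff_right blinfun.scaleR_right)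
  then show ?case by blast
qed

lemma box_zero_imp_tensor_zero:
  fixes e :: "'i \<Rightarrow> ('b::real_normed_vector \<Rightarrow>\<^sub>L real)" and x y :: "'i \<Rightarrow> 'a::{metric_space,zero}"
  assumes fin: "finite I" and zero: "(\<Sum>i\<in>I. delta_box (x i) (y i) (e i)) = 0"
  shows "(\<Sum>i\<in>I. fdelta (x i) (y i) \<otimes>\<^sub>t e i) = 0"
proof -
  obtain S where S: "S \<subseteq> e ` I" "independent S" "e ` I \<subseteq> span S"
    using maximal_independent_subset by blast
  have finS: "finite S" using S(1) fin finite_surj by blast
  obtain a where a: "\<And>s t. s \<in> S \<Longrightarrow> t \<in> S \<Longrightarrow> blinfun_apply t (a s) = (if s = t then 1 else 0)"
    using biorthogonal[OF finS S(2)] by blast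
  have ei: "e i = (\<Sum>s\<in>S. blinfun_apply (e i) (a s) *\<^sub>R s)" if i: "i \<in> I" for i
  proof -
    obtain r where r: "e i = (\<Sum>s\<in>S. r s *\<^sub>R s)"
      using i S(3) span_finite[OF finS] by blast
    have "blinfun_apply (e i) (a t) = r t" if t: "t \<in> S" for t
    proof -
      have "blinfun_apply (e i) (a t) = (\<Sum>s\<in>S. r s * blinfun_apply s (a t))"
        by (simp add: r blinfun.sum_left blinfun.scaleR_left)
      also have "\<dots> = (\<Sum>s\<in>S. if s = t then r s else 0)"
        using a t by (intro sum.cong) auto
      finally show ?thesis using t finS by simp
    qed
    then have "(\<Sum>s\<in>S. blinfun_apply (e i) (a s) *\<^sub>R s) = (\<Sum>s\<in>S. r s *\<^sub>R s)"
      by (intro sum.cong) auto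
    then show ?thesis by (simp add: r)
  qed
  have m0: "(\<Sum>i\<in>I. blinfun_apply (e i) (a s) *\<^sub>R mdelta (x i) (y i)) = 0" for s
  proof -
    have "(\<Sum>i\<in>I. blinfun_apply (e i) (a s) * (lip_app g (x i) - lip_app g (y i))) = 0" for g
    proof -
      define ev :: "('b \<Rightarrow>\<^sub>L real) \<Rightarrow>\<^sub>L real" where "ev = Blinfun (\<lambda>h. blinfun_apply h (a s))"
      have ev: "blinfun_apply ev h = blinfun_apply h (a s)" for h
        unfolding ev_def
        by (simp add: bounded_linear_Blinfun_apply blinfun.bounded_linear_left)
      obtain L where L: "L-lipschitz_on UNIV (lip_app g)" by (rule lip_app_lipschitz)
      have g0: "lip_app g 0 = 0" using lip_app[of g] by (simp add: Lip0_def)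
      have "(L * norm ev)-lipschitz_on UNIV (\<lambda>z. lip_app g z *\<^sub>R ev)"
      proof (rule lipschitz_onI)
        fix u v
        have "dist (lip_app g u *\<^sub>R ev) (lip_app g v *\<^sub>R ev) = \<bar>lip_app g u - lip_app g v\<bar> * norm ev"
          by (simp add: dist_norm flip: scaleR_diff_left)
        also have "\<dots> \<le> (L * dist u v) * norm ev"
          by (intro mult_right_mono lip_on_dist[OF L]) simp
        finally show "dist (lip_app g u *\<^sub>R ev) (lip_app g v *\<^sub>R ev) \<le> L * norm ev * dist u v"
          by (simp add: mult_ac)
      qed (use L in \<open>simp add: lipschitz_on_def\<close>)
      then have mem: "(\<lambda>z. lip_app g z *\<^sub>R ev) \<in> Lip0"
        using g0 by (auto simp: Lip0_def)
      have "rapp (\<Sum>i\<in>I. delta_box (x i) (y i) (e i)) (Lip_Abs (\<lambda>z. lip_app g z *\<^sub>R ev)) = 0"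
        by (simp only: zero rapp_simps)
      then show ?thesis
        by (simp add: delta_box_def Lip_Abs_inverse[OF mem] blinfun.diff_left blinfun.scaleR_left ev
            algebra_simps)
    qed
    then have "mol_rep (\<Sum>i\<in>I. blinfun_apply (e i) (a s) *\<^sub>R mdelta (x i) (y i)) = mol_rep 0"
      by (intro rfun_eqI)
         (simp add: mol_rep_sum scaleR_molecule.rep_eq mdelta.rep_eq delta_def zero_molecule.rep_eq)
    then show ?thesis by (simp add: mol_rep_inject)
  qed
  have f0: "(\<Sum>i\<in>I. blinfun_apply (e i) (a s) *\<^sub>R fdelta (x i) (y i)) = 0" for s
    using arg_cong[OF m0[of s], of to_completion]
    by (simp add: fdelta_def linear_sum[OF linear_to_completion]
        linear_cmul[OF linear_to_completion] linear_0[OF linear_to_completion])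
  have lr: "linear (\<lambda>w :: 'b \<Rightarrow>\<^sub>L real. v \<otimes>\<^sub>t w)" for v :: "'a free_space"
    using bilinear_tensor_pair unfolding bilinear_def by blast
  have ll: "linear (\<lambda>v :: 'a free_space. v \<otimes>\<^sub>t w)" for w :: "'b \<Rightarrow>\<^sub>L real"
    using bilinear_tensor_pair unfolding bilinear_def by blast
  have "(\<Sum>i\<in>I. fdelta (x i) (y i) \<otimes>\<^sub>t e i)
      = (\<Sum>i\<in>I. \<Sum>s\<in>S. blinfun_apply (e i) (a s) *\<^sub>R (fdelta (x i) (y i) \<otimes>\<^sub>t s))"
  proof (rule sum.cong[OF refl])
    fix i assume "i \<in> I"
    have "fdelta (x i) (y i) \<otimes>\<^sub>t e i
      = fdelta (x i) (y i) \<otimes>\<^sub>t (\<Sum>s\<in>S. blinfun_apply (e i) (a s) *\<^sub>R s)"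
      using ei[OF \<open>i \<in> I\<close>] by simp
    then show "fdelta (x i) (y i) \<otimes>\<^sub>t e i
      = (\<Sum>s\<in>S. blinfun_apply (e i) (a s) *\<^sub>R (fdelta (x i) (y i) \<otimes>\<^sub>t s))"
      by (simp add: linear_sum[OF lr] linear_cmul[OF lr])
  qed
  also have "\<dots> = (\<Sum>s\<in>S. \<Sum>i\<in>I. blinfun_apply (e i) (a s) *\<^sub>R (fdelta (x i) (y i) \<otimes>\<^sub>t s))"
    by (rule sum.swap)
  also have "\<dots> = (\<Sum>s\<in>S. (\<Sum>i\<in>I. blinfun_apply (e i) (a s) *\<^sub>R fdelta (x i) (y i)) \<otimes>\<^sub>t s)"
    by (simp add: linear_sum[OF ll] linear_cmul[OF ll])
  also have "\<dots> = 0" by (simp add: f0 linear_0[OF ll])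
  finally show ?thesis .
qed

lemma box_to_tensor_sum:
  fixes e :: "nat \<Rightarrow> ('b::real_normed_vector \<Rightarrow>\<^sub>L real)" and x y :: "nat \<Rightarrow> 'a::{metric_space,zero}"
  shows "box_to_tensor (\<Sum>i<n::nat. delta_box (x i) (y i) (e i)) = (\<Sum>i<n. fdelta (x i) (y i) \<otimes>\<^sub>t e i)"
  unfolding box_to_tensor_def
proof (rule the_equality)
  fix v assume "\<exists>m x' y' e'.
     (\<Sum>i<n. delta_box (x i) (y i) (e i)) = (\<Sum>i<m::nat. delta_box (x' i) (y' i) (e' i)) \<and>
     v = (\<Sum>i<m. fdelta (x' i) (y' i) \<otimes>\<^sub>t e' i)"
  then obtain m x' y' e' where
    eq: "(\<Sum>i<n. delta_box (x i) (y i) (e i)) = (\<Sum>i<m::nat. delta_box (x' i) (y' i) (e' i))"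
    and v: "v = (\<Sum>i<m. fdelta (x' i) (y' i) \<otimes>\<^sub>t e' i)" by blast
  let ?I = "{..<n} <+> {..<m}"
  let ?x = "case_sum x x'" and ?y = "case_sum y y'" and ?e = "case_sum e (\<lambda>i. - e' i)"
  have neg: "delta_box z w (- h) = - delta_box z w h"
    for z w :: 'a and h :: "'b \<Rightarrow>\<^sub>L real"
    by (rule rfun_eqI) (simp add: delta_box_def blinfun.minus_right)
  have negt: "z \<otimes>\<^sub>t (- h) = - (z \<otimes>\<^sub>t h)" for z :: "'a free_space" and h :: "'b \<Rightarrow>\<^sub>L real"
    by (rule bilinear_rneg[OF bilinear_tensor_pair])
  have "(\<Sum>i\<in>?I. delta_box (?x i) (?y i) (?e i)) = 0"
    using eq by (simp add: sum.Plus neg sum_negf)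
  then have "(\<Sum>i\<in>?I. fdelta (?x i) (?y i) \<otimes>\<^sub>t ?e i) = 0"
    by (intro box_zero_imp_tensor_zero) auto
  then show "v = (\<Sum>i<n. fdelta (x i) (y i) \<otimes>\<^sub>t e i)"
    by (simp add: sum.Plus v negt sum_negf)
qed blast

definition d_p_lip :: "real \<Rightarrow>
    ('a::{metric_space,zero}, ('b::real_normed_vector \<Rightarrow>\<^sub>L real) \<Rightarrow>\<^sub>L real) lip0 rfun \<Rightarrow> real" where
  "d_p_lip p u = d_p p (box_to_tensor u)"

definition strictly_lipschitz_p_summing_const ::
  "real \<Rightarrow> ('a::{metric_space,zero} \<Rightarrow> 'b::real_normed_vector) \<Rightarrow> real \<Rightarrow> bool" where
  "strictly_lipschitz_p_summing_const p T C \<longleftrightarrow> C > 0 \<and>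
     (\<forall>n x y (e :: nat \<Rightarrow> 'b \<Rightarrow>\<^sub>L real).
        \<bar>\<Sum>i<n. blinfun_apply (e i) (T (x i) - T (y i))\<bar> \<le>
        C * d_p_lip p (\<Sum>i<n. delta_box (x i) (y i) (e i)))"

definition strictly_lipschitz_p_summing ::
  "real \<Rightarrow> ('a::{metric_space,zero} \<Rightarrow> 'b::real_normed_vector) \<Rightarrow> bool" where
  "strictly_lipschitz_p_summing p T \<longleftrightarrow>
     T \<in> Lip0 \<and> (\<exists>C. strictly_lipschitz_p_summing_const p T C)"

definition strictly_lipschitz_p_summing_norm ::
  "real \<Rightarrow> ('a::{metric_space,zero} \<Rightarrow> 'b::real_normed_vector) \<Rightarrow> real" where
  "strictly_lipschitz_p_summing_norm p T = Inf {C. strictly_lipschitz_p_summing_const p T C}"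

end

theory Submission
  imports Defs
begin

text \<open>For each constant \<open>C > 0\<close> the three summing inequalities are equivalent, so the three sets of
  admissible constants coincide, and with them their infima. The equivalence is a cycle.

  Lipschitz summing implies summing. This is the deep step, because the Lipschitz inequality only
  bounds \<open>(\<Sum>i. \<parallel>T x\<^sub>i\<parallel>\<^sup>p)\<close> by a supremum over nonlinear functions \<open>f\<close>. The idea is to differentiate
  \<open>f\<close>. Since \<open>T\<close> is linear, the inequality may be applied to the pairs \<open>(z + L x\<^sub>i, z)\<close> with \<open>z\<close> running
  over any finite set of points, and produces a 1-Lipschitz \<open>f\<close> whose difference quotients at scale
  \<open>L\<close> are large on average. Average \<open>f\<close> over a grid of side \<open>R\<close>, much smaller than
  \<open>L\<close>, in directions \<open>v\<^sub>1, \<dots>, v\<^sub>k\<close> that include the \<open>x\<^sub>i\<close>. The result \<open>G\<close> is close to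
  \<open>f\<close>, hence still has large quotients at scale \<open>L\<close>; by convexity of \<open>t\<^sup>p\<close> its unit increments \<open>G (z + x\<^sub>i) - G z\<close> are large for some \<open>z\<close>; and
  the increments of \<open>G\<close> in the directions \<open>v\<^sub>j\<close> are \<open>2/R\<close>-Lipschitz, so that \<open>u \<mapsto> G (z + u) - G z\<close>
  is almost additive (\<open>exists_almost_additive_lipschitz\<close>). The functions so obtained lie in a
  product of compact intervals, and by Tychonoff's theorem there is one that is exactly additive in
  all directions: a linear functional of norm at most 1
  (\<open>linear_functional_of_lipschitz_energy\<close>). Thus the supremum over Lipschitz functions can be
  replaced by one over functionals, and Hoelder's inequality gives the bound by the tensor norm.

  Summing implies strictly Lipschitz summing. The identity of a Banach space \<open>X\<close> factors through the
  free space: there is a linear contraction \<open>\<beta>\<close> from it to \<open>X\<close> with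
  \<open>\<beta> \<delta>\<^bsub>(x,y)\<^esub> = x - y\<close> (\<open>barycentre\<close>). Composing \<open>T\<close> with \<open>\<beta>\<close> does not increase the constant.

  Strictly Lipschitz summing implies Lipschitz summing. Test the tensor inequality on functionals
  that norm the increments of \<open>T\<close>, weighted by the powers that make Hoelder's inequality sharp, and
  observe that a functional on the free space is a Lipschitz function on \<open>X\<close>.\<close>

section \<open>Inequalities for powers\<close>

lemma convex_on_powr_nonneg:
  fixes p :: real
  assumes "1 \<le> p"
  shows "convex_on {0..} (\<lambda>x::real. x powr p)"
proof (rule convex_onI)
  fix t x y :: real
  assume t: "0 < t" "t < 1" and xy: "x \<in> {0..}" "y \<in> {0..}"
  have small: "s powr p \<le> s" if "0 < s" "s < 1" for s :: real
    using powr_mono'[of 1 p s] that assms by simp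
  consider "x = 0" | "y = 0" | "x > 0" "y > 0" using xy by fastforce
  then show "((1 - t) *\<^sub>R x + t *\<^sub>R y) powr p \<le> (1 - t) * x powr p + t * y powr p"
  proof cases
    case 1
    then show ?thesis using small[of t] t xy by (simp add: powr_mult mult_right_mono)
  next
    case 2
    then show ?thesis using small[of "1 - t"] t xy by (simp add: powr_mult mult_right_mono)
  next
    case 3
    then show ?thesis using convex_onD[OF powr_convex[OF assms], of t x y] t by simp
  qed
qed simp

lemma powr_mean_le:
  fixes a :: "nat \<Rightarrow> real"
  assumes "1 \<le> p" "0 < L" "\<And>s. s < L \<Longrightarrow> 0 \<le> a s"
  shows "((\<Sum>s<L. a s) / L) powr p \<le> (\<Sum>s<L. a s powr p) / L"
proof -
  have "(\<Sum>s<L. (1 / real L) *\<^sub>R a s) powr p \<le> (\<Sum>s<L. (1 / real L) * (a s powr p))"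
    using assms by (intro convex_on_sum[OF _ _ convex_on_powr_nonneg]) auto
  then show ?thesis by (simp add: sum_divide_distrib)
qed

text \<open>The error made in replacing a function by its average has to survive the \<open>p\<close>-th power; on a
  bounded range this is uniform continuity.\<close>

lemma powr_uniform_continuity:
  fixes p M \<epsilon> :: real
  assumes "0 < p" "0 < \<epsilon>"
  obtains \<delta> where "0 < \<delta>"
    "\<And>a b. 0 \<le> a \<Longrightarrow> a \<le> M \<Longrightarrow> 0 \<le> b \<Longrightarrow> b \<le> M \<Longrightarrow> \<bar>a - b\<bar> < \<delta> \<Longrightarrow> a powr p \<le> b powr p + \<epsilon>"
proof -
  have "continuous_on {0..M} (\<lambda>x. x powr p)"
    using assms by (intro continuous_on_powr') (auto intro!: continuous_intros)
  then have "uniformly_continuous_on {0..M} (\<lambda>x. x powr p)"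
    by (intro compact_uniformly_continuous) auto
  then obtain d where d: "d > 0" "\<And>a b. a \<in> {0..M} \<Longrightarrow> b \<in> {0..M} \<Longrightarrow> dist b a < d \<Longrightarrow>
      dist (b powr p) (a powr p) < \<epsilon>"
    using assms(2) unfolding uniformly_continuous_on_def by metis
  show thesis
  proof (rule that[OF d(1)])
    fix a b :: real
    assume "0 \<le> a" "a \<le> M" "0 \<le> b" "b \<le> M" "\<bar>a - b\<bar> < d"
    then show "a powr p \<le> b powr p + \<epsilon>"
      using d(2)[of b a] by (auto simp: dist_real_def)
  qed
qed

text \<open>Young's inequality summed after normalising both factors; when a factor has norm zero, all
  products vanish.\<close>

lemma Hoelder_powr_sum:
  fixes a b :: "nat \<Rightarrow> real"
  assumes p: "1 < p" and a: "\<And>i. 0 \<le> a i" and b: "\<And>i. 0 \<le> b i"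
  defines "q \<equiv> p / (p - 1)"
  shows "(\<Sum>i<n. a i * b i) \<le> (\<Sum>i<n. a i powr p) powr (1 / p) * (\<Sum>i<n. b i powr q) powr (1 / q)"
proof -
  have q: "1 < q" "1 / p + 1 / q = 1" using p by (simp_all add: q_def field_simps)
  define \<alpha> \<beta> where "\<alpha> = (\<Sum>i<n. a i powr p) powr (1 / p)" and "\<beta> = (\<Sum>i<n. b i powr q) powr (1 / q)"
  have \<alpha>p: "\<alpha> powr p = (\<Sum>i<n. a i powr p)" and \<beta>q: "\<beta> powr q = (\<Sum>i<n. b i powr q)"
    using p q(1) by (simp_all add: \<alpha>_def \<beta>_def powr_powr sum_nonneg)
  show ?thesis
  proof (cases "\<alpha> = 0 \<or> \<beta> = 0")
    case True
    then have "a i * b i = 0" if "i < n" for i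
    proof
      assume "\<alpha> = 0"
      then have "(\<Sum>i<n. a i powr p) = 0" using \<alpha>p p by simp
      then have "a i powr p = 0" using that by (simp add: sum_nonneg_eq_0_iff)
      then show ?thesis by simp
    next
      assume "\<beta> = 0"
      then have "(\<Sum>i<n. b i powr q) = 0" using \<beta>q q by simp
      then have "b i powr q = 0" using that by (simp add: sum_nonneg_eq_0_iff)
      then show ?thesis by simp
    qed
    then have "(\<Sum>i<n. a i * b i) = 0" by (intro sum.neutral) auto
    then show ?thesis by simp
  next
    case False
    then have pos: "0 < \<alpha>" "0 < \<beta>" unfolding \<alpha>_def \<beta>_def by (simp_all add: less_le)
    have "(\<Sum>i<n. (a i / \<alpha>) * (b i / \<beta>)) \<le> (\<Sum>i<n. (a i / \<alpha>) powr p / p + (b i / \<beta>) powr q / q)"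
      using p q a b pos by (intro sum_mono Youngs_inequality) auto
    also have "\<dots> = (\<Sum>i<n. a i powr p) / \<alpha> powr p / p + (\<Sum>i<n. b i powr q) / \<beta> powr q / q"
      using a b pos by (simp add: powr_divide sum.distrib sum_divide_distrib)
    also have "\<dots> = 1" using q(2) pos by (simp flip: \<alpha>p \<beta>q)
    finally have "(\<Sum>i<n. a i * b i) / (\<alpha> * \<beta>) \<le> 1" by (simp add: sum_divide_distrib)
    then show ?thesis using pos by (simp add: \<alpha>_def[symmetric] \<beta>_def[symmetric] field_simps)
  qed
qed

section \<open>Averages over grids\<close>

definition mean :: "'a::real_vector list \<Rightarrow> ('a \<Rightarrow> real) \<Rightarrow> 'a \<Rightarrow> real" where
  "mean zs h z = (\<Sum>u\<leftarrow>zs. h (z + u)) / length zs"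

lemma mean_mono:
  assumes "\<And>u. u \<in> set zs \<Longrightarrow> h (z + u) \<le> k (w + u)"
  shows "mean zs h z \<le> mean zs k w"
  unfolding mean_def using assms by (intro divide_right_mono sum_list_mono) auto

lemma mean_const: "zs \<noteq> [] \<Longrightarrow> mean zs (\<lambda>_. c) z = c"
  by (simp add: mean_def sum_list_triv)

lemma mean_add: "mean zs (\<lambda>z. h z + k z) z = mean zs h z + mean zs k z"
  by (simp add: mean_def sum_list_addf add_divide_distrib)

lemma mean_diff: "mean zs (\<lambda>z. h z - k z) z = mean zs h z - mean zs k z"
  by (simp add: mean_def sum_list_subtractf diff_divide_distrib)

lemma mean_cmult: "mean zs (\<lambda>z. c * h z) z = c * mean zs h z"
  by (simp add: mean_def sum_list_const_mult)

lemma mean_sum: "mean zs (\<lambda>z. \<Sum>i\<in>I. h i z) z = (\<Sum>i\<in>I. mean zs (h i) z)"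
  by (induction I rule: infinite_finite_induct)
     (auto simp: mean_add mean_def)

lemma mean_shift: "mean zs (\<lambda>z. h (z + w)) z = mean zs h (z + w)"
  by (simp add: mean_def algebra_simps)

lemma mean_nth: "mean zs h z = (\<Sum>k<length zs. h (z + zs ! k)) / length zs"
  by (simp add: mean_def sum_list_sum_nth atLeast0LessThan)

text \<open>The two base points and the two functions are allowed to differ so that the same bound gives the
  Lipschitz constant of an average (\<open>h = k\<close>) and its distance to the function (\<open>k\<close> constant).\<close>

lemma abs_mean_diff_le:
  assumes "zs \<noteq> []" "\<And>u. u \<in> set zs \<Longrightarrow> \<bar>h (z + u) - k (w + u)\<bar> \<le> c"
  shows "\<bar>mean zs h z - mean zs k w\<bar> \<le> c"
proof -
  have "mean zs h z \<le> mean zs (\<lambda>y. c + k (y + (w - z))) z"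
    using assms(2) by (intro mean_mono) (auto simp: algebra_simps abs_le_iff)
  also have "\<dots> = c + mean zs k w"
    using assms(1) by (simp add: mean_add mean_shift mean_const)
  finally have 1: "mean zs h z \<le> c + mean zs k w" .
  have "mean zs k w \<le> mean zs (\<lambda>y. c + h (y + (z - w))) w"
    using assms(2) by (intro mean_mono) (auto simp: algebra_simps abs_le_iff)
  also have "\<dots> = c + mean zs h z"
    using assms(1) by (simp add: mean_add mean_shift mean_const)
  finally show ?thesis using 1 by linarith
qed

text \<open>The points \<open>s\<^sub>1 v\<^sub>1 + \<dots> + s\<^sub>k v\<^sub>k\<close> with \<open>0 \<le> s\<^sub>j < N\<close>, listed with multiplicity. The directions may
  be linearly dependent or repeated, so a grid is a list and not a set of points.\<close>

primrec grid :: "nat \<Rightarrow> 'a::real_vector list \<Rightarrow> 'a list" where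
  "grid N [] = [0]"
| "grid N (v # vs) = concat (map (\<lambda>s. map (\<lambda>u. real s *\<^sub>R v + u) (grid N vs)) [0..<N])"

lemma length_grid: "length (grid N vs) = N ^ length vs"
  by (induction vs) (auto simp: length_concat o_def sum_list_triv)

lemma grid_nonempty: "0 < N \<Longrightarrow> grid N vs \<noteq> []"
  by (metis length_grid length_0_conv power_eq_0_iff less_irrefl)

lemma norm_grid_le:
  "u \<in> set (grid N vs) \<Longrightarrow> norm (u::'a::real_normed_vector) \<le> N * (\<Sum>v\<leftarrow>vs. norm v)"
proof (induction vs arbitrary: u)
  case (Cons v vs)
  then obtain s w where s: "s < N" and w: "w \<in> set (grid N vs)" and u: "u = real s *\<^sub>R v + w"
    by auto
  have "norm u \<le> real s * norm v + norm w"
    unfolding u by (rule order_trans[OF norm_triangle_ineq]) simp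
  also have "\<dots> \<le> N * norm v + N * (\<Sum>v\<leftarrow>vs. norm v)"
    using s Cons.IH[OF w] by (intro add_mono mult_right_mono) auto
  finally show ?case by (simp add: distrib_left)
qed simp

text \<open>A grid average is an iterated average, one direction after the other. This drives all inductions
  over the directions.\<close>

lemma mean_grid_Cons:
  "mean (grid N (v # vs)) h z = (\<Sum>s<N. mean (grid N vs) h (z + real s *\<^sub>R v)) / N"
proof -
  have "(\<Sum>u\<leftarrow>grid N (v # vs). h (z + u))
      = (\<Sum>s<N. \<Sum>u\<leftarrow>grid N vs. h (z + real s *\<^sub>R v + u))"
  proof -
    have "(\<Sum>u\<leftarrow>concat (map (\<lambda>s. map (\<lambda>u. real s *\<^sub>R v + u) (grid N vs)) ss). h (z + u))
        = (\<Sum>s\<leftarrow>ss. \<Sum>u\<leftarrow>grid N vs. h (z + real s *\<^sub>R v + u))" for ss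
      by (induction ss) (simp_all add: o_def add.assoc)
    then show ?thesis
      by (simp add: interv_sum_list_conv_sum_set_nat atLeast0LessThan)
  qed
  moreover have "length (grid N (v # vs)) = N * length (grid N vs)"
    by (simp only: length_grid length_Cons power_Suc)
  ultimately show ?thesis
    by (simp add: mean_def divide_divide_eq_left mult.commute flip: sum_divide_distrib del: grid.simps)
qed

text \<open>In the direction \<open>v\<close> itself the increment of the iterated average telescopes: only the two opposite
  faces of the grid remain, and they make up a fraction \<open>2/N\<close> of it. Averaging in the other
  directions preserves the bound. The estimate is used twice: to see that the increments of an
  averaged Lipschitz function are nearly constant, and to shift the base point in a much larger
  grid.\<close>

lemma mean_grid_almost_invariant:
  assumes "v \<in> set vs" "0 < N" "\<And>z. \<bar>h z\<bar> \<le> M"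
  shows "\<bar>mean (grid N vs) h (z + v) - mean (grid N vs) h z\<bar> \<le> 2 * M / N"
  using assms(1)
proof (induction vs arbitrary: z)
  case (Cons w vs)
  define a where "a = mean (grid N vs) h"
  have a: "\<bar>a z\<bar> \<le> M" for z
    using abs_mean_diff_le[of "grid N vs" h z "\<lambda>_. 0" z M] assms(3)
    by (simp add: mean_const a_def grid_nonempty[OF assms(2)])
  have eq: "mean (grid N (w # vs)) h (z + v) - mean (grid N (w # vs)) h z
      = (\<Sum>s<N. a (z + v + real s *\<^sub>R w) - a (z + real s *\<^sub>R w)) / N"
    by (simp add: mean_grid_Cons a_def sum_subtractf diff_divide_distrib del: grid.simps)
  have "\<bar>\<Sum>s<N. a (z + v + real s *\<^sub>R w) - a (z + real s *\<^sub>R w)\<bar> \<le> 2 * M"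
  proof (cases "v = w")
    case True
    have "(\<Sum>s<N. a (z + v + real s *\<^sub>R w) - a (z + real s *\<^sub>R w))
        = (\<Sum>s<N. a (z + real (Suc s) *\<^sub>R w) - a (z + real s *\<^sub>R w))"
      unfolding True by (simp add: algebra_simps)
    also have "\<dots> = a (z + real N *\<^sub>R w) - a z"
      by (simp only: sum_lessThan_telescope[of "\<lambda>s. a (z + real s *\<^sub>R w)"]) simp
    finally show ?thesis using a[of "z + real N *\<^sub>R w"] a[of z] by linarith
  next
    case False
    then have v: "v \<in> set vs" using Cons.prems by simp
    have "\<bar>a (z + v + real s *\<^sub>R w) - a (z + real s *\<^sub>R w)\<bar> \<le> 2 * M / N" for s
      using Cons.IH[OF v, of "z + real s *\<^sub>R w"] by (simp add: a_def ac_simps)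
    then have "\<bar>\<Sum>s<N. a (z + v + real s *\<^sub>R w) - a (z + real s *\<^sub>R w)\<bar> \<le> (\<Sum>s<N. 2 * M / N)"
      by (intro order_trans[OF sum_abs] sum_mono) auto
    then show ?thesis using assms(2) by simp
  qed
  then show ?case unfolding eq using assms(2) by (simp add: divide_right_mono)
qed simp

section \<open>Linear functionals from Lipschitz functions\<close>

text \<open>A discrete substitute for differentiation at a point. Three scales occur: \<open>f\<close> is smoothed over a
  grid of side \<open>R\<close>, its increments are measured at distance \<open>L\<close>, and the mean energy is taken over a
  grid of side \<open>N\<close>. They are chosen in this order, each large compared with the previous one.
  With \<open>B = (\<Sum>v\<leftarrow>vs. \<parallel>v\<parallel>)\<close>, near-additivity costs \<open>2/R\<close>, passing from \<open>f\<close> to its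
  average \<open>G\<close> changes the difference quotients by at most \<open>2 R B / L\<close>, and moving the base point by at most \<open>L\<close> steps inside the large grid costs
  \<open>2 L B\<^sup>p / N\<close>.\<close>

lemma exists_almost_additive_lipschitz:
  fixes x :: "nat \<Rightarrow> 'a::real_normed_vector"
  assumes p: "1 \<le> p" and eps: "0 < \<epsilon>" and vs: "\<And>i. i < n \<Longrightarrow> x i \<in> set vs"
    and energy: "\<And>zs (L::nat). zs \<noteq> [] \<Longrightarrow> 0 < L \<Longrightarrow> \<exists>f. 1-lipschitz_on UNIV f \<and>
      A \<le> mean zs (\<lambda>z. \<Sum>i<n. (\<bar>f (z + real L *\<^sub>R x i) - f z\<bar> / L) powr p) 0"
  shows "\<exists>\<psi>::'a \<Rightarrow> real. \<psi> 0 = 0 \<and> (\<forall>u v. \<bar>\<psi> u - \<psi> v\<bar> \<le> norm (u - v)) \<and>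
      (\<forall>v\<in>set vs. \<forall>u. \<bar>\<psi> (u + v) - \<psi> u - \<psi> v\<bar> \<le> \<epsilon> * norm u) \<and>
      A - \<epsilon> \<le> (\<Sum>i<n. \<bar>\<psi> (x i)\<bar> powr p)"
proof -
  define B where "B = (\<Sum>v\<leftarrow>vs. norm v)"
  have B0: "0 \<le> B" unfolding B_def by (intro sum_list_nonneg) auto
  have xB: "norm (x i) \<le> B" if "i < n" for i
  proof -
    have "norm (x i) \<in> set (map norm vs)" using vs[OF that] by simp
    then show ?thesis unfolding B_def by (rule member_le_sum_list) auto
  qed
  define \<epsilon>' where "\<epsilon>' = \<epsilon> / (4 * (real n + 1))"
  have eps': "0 < \<epsilon>'" using eps by (simp add: \<epsilon>'_def)
  obtain R :: nat where R: "2 / \<epsilon> < R" using reals_Archimedean2 by blast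
  have R0: "0 < real R" using eps by (intro le_less_trans[OF _ R]) simp
  then have R0': "0 < R" by simp
  have R2: "2 / R \<le> \<epsilon>" using R R0 eps by (simp add: field_simps)
  obtain \<delta> where \<delta>: "0 < \<delta>" "\<And>a b. 0 \<le> a \<Longrightarrow> a \<le> B \<Longrightarrow> 0 \<le> b \<Longrightarrow> b \<le> B \<Longrightarrow> \<bar>a - b\<bar> < \<delta> \<Longrightarrow>
      a powr p \<le> b powr p + \<epsilon>'"
    using powr_uniform_continuity[of p \<epsilon>' B] p eps' by auto
  obtain L :: nat where L: "2 * R * B / \<delta> < L" using reals_Archimedean2 by blast
  have L0: "0 < real L" using R0 B0 \<delta>(1) by (intro le_less_trans[OF _ L]) simp
  then have L0': "0 < L" by simp
  have L2: "2 * R * B / L < \<delta>" using L L0 \<delta>(1) by (simp add: field_simps)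
  obtain N :: nat where N: "2 * L * B powr p / \<epsilon>' < N" using reals_Archimedean2 by blast
  have N0: "0 < real N" using eps' by (intro le_less_trans[OF _ N]) simp
  then have N0': "0 < N" by simp
  have N2: "2 * L * B powr p / N \<le> \<epsilon>'" using N N0 eps' by (simp add: field_simps)
  define zs where "zs = grid N vs"
  have zs: "zs \<noteq> []" unfolding zs_def by (rule grid_nonempty[OF N0'])
  obtain f where f: "1-lipschitz_on UNIV f"
    and A: "A \<le> mean zs (\<lambda>z. \<Sum>i<n. (\<bar>f (z + real L *\<^sub>R x i) - f z\<bar> / L) powr p) 0"
    using energy[OF zs L0'] by blast
  have fl: "\<bar>f u - f v\<bar> \<le> norm (u - v)" for u v
    using lip_on_dist[OF f, of u v] by (simp add: dist_norm)
  have rs: "grid R vs \<noteq> []" by (rule grid_nonempty[OF R0'])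
  define G where "G = mean (grid R vs) f"
  have Gl: "\<bar>G u - G v\<bar> \<le> norm (u - v)" for u v
    unfolding G_def using rs
  proof (rule abs_mean_diff_le)
    show "\<bar>f (u + w) - f (v + w)\<bar> \<le> norm (u - v)" for w
      using fl[of "u + w" "v + w"] by simp
  qed
  have Gf: "\<bar>G u - f u\<bar> \<le> R * B" for u
  proof -
    have "\<bar>mean (grid R vs) f u - mean (grid R vs) (\<lambda>_. f u) u\<bar> \<le> R * B"
    proof (rule abs_mean_diff_le[OF rs])
      fix w assume "w \<in> set (grid R vs)"
      then have "norm w \<le> R * B" unfolding B_def by (rule norm_grid_le)
      then show "\<bar>f (u + w) - f u\<bar> \<le> R * B" using fl[of "u + w" u] by simp
    qed
    then show ?thesis by (simp add: G_def mean_const[OF rs])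
  qed
  \<comment> \<open>The increment of \<open>G\<close> by \<open>u\<close> is the average of the increment of \<open>f\<close> by \<open>u\<close>, a function bounded
    by \<open>\<parallel>u\<parallel>\<close>; hence it hardly changes under a shift by a grid direction.\<close>
  have D: "\<bar>(G (z + u + v) - G (z + v)) - (G (z + u) - G z)\<bar> \<le> \<epsilon> * norm u" if "v \<in> set vs" for u v z
  proof -
    have "\<bar>mean (grid R vs) (\<lambda>z. f (z + u) - f z) (z + v) - mean (grid R vs) (\<lambda>z. f (z + u) - f z) z\<bar>
        \<le> 2 * norm u / R"
    proof (rule mean_grid_almost_invariant[OF that R0'])
      show "\<bar>f (z + u) - f z\<bar> \<le> norm u" for z using fl[of "z + u" z] by simp
    qed
    also have "\<dots> = (2 / R) * norm u" by simp
    also have "\<dots> \<le> \<epsilon> * norm u" by (rule mult_right_mono[OF R2]) simp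
    finally show ?thesis by (simp add: mean_diff mean_shift G_def add_ac)
  qed
  define h where "h i z = \<bar>G (z + x i) - G z\<bar> powr p" for i z
  have h0: "0 \<le> h i z" for i z by (simp add: h_def)
  have hB: "h i z \<le> B powr p" if "i < n" for i z
    unfolding h_def using Gl[of "z + x i" z] xB[OF that] p by (intro powr_mono2) auto
  \<comment> \<open>Replace \<open>f\<close> by \<open>G\<close>, split the increment of \<open>G\<close> over the distance \<open>L\<close> into \<open>L\<close> unit increments and
    use convexity.\<close>
  have main: "(\<bar>f (z + real L *\<^sub>R x i) - f z\<bar> / L) powr p
      \<le> (\<Sum>s<L. h i (z + real s *\<^sub>R x i)) / L + \<epsilon>'" if i: "i < n" for i z
  proof -
    let ?a = "\<bar>f (z + real L *\<^sub>R x i) - f z\<bar> / L" and ?b = "\<bar>G (z + real L *\<^sub>R x i) - G z\<bar> / L"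
    have nb: "norm (real L *\<^sub>R x i) \<le> B * L"
      using mult_left_mono[OF xB[OF i], of "real L"] by (simp add: mult.commute)
    have "?a \<le> B" "?b \<le> B"
      using fl[of "z + real L *\<^sub>R x i" z] Gl[of "z + real L *\<^sub>R x i" z] nb L0
      by (auto simp add: pos_divide_le_eq simp del: norm_scaleR)
    moreover have "\<bar>?a - ?b\<bar> < \<delta>"
    proof -
      have "\<bar>\<bar>f (z + real L *\<^sub>R x i) - f z\<bar> - \<bar>G (z + real L *\<^sub>R x i) - G z\<bar>\<bar> \<le> 2 * R * B"
        using Gf[of "z + real L *\<^sub>R x i"] Gf[of z] by linarith
      then have "\<bar>\<bar>f (z + real L *\<^sub>R x i) - f z\<bar> - \<bar>G (z + real L *\<^sub>R x i) - G z\<bar>\<bar> / L \<le> 2 * R * B / L"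
        using L0 by (intro divide_right_mono) auto
      then show ?thesis using L2 L0
        by (simp add: abs_divide flip: diff_divide_distrib)
    qed
    ultimately have "?a powr p \<le> ?b powr p + \<epsilon>'" using L0 by (intro \<delta>(2)) auto
    also have "?b powr p \<le> ((\<Sum>s<L. \<bar>G (z + real s *\<^sub>R x i + x i) - G (z + real s *\<^sub>R x i)\<bar>) / L) powr p"
    proof (intro powr_mono2 divide_right_mono)
      have "(\<Sum>s<L. G (z + real s *\<^sub>R x i + x i) - G (z + real s *\<^sub>R x i)) =
          (\<Sum>s<L. G (z + real (Suc s) *\<^sub>R x i) - G (z + real s *\<^sub>R x i))"
        by (simp add: algebra_simps)
      also have "\<dots> = G (z + real L *\<^sub>R x i) - G z"
        by (simp only: sum_lessThan_telescope[of "\<lambda>s. G (z + real s *\<^sub>R x i)"]) simp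
      finally show "\<bar>G (z + real L *\<^sub>R x i) - G z\<bar> \<le>
          (\<Sum>s<L. \<bar>G (z + real s *\<^sub>R x i + x i) - G (z + real s *\<^sub>R x i)\<bar>)"
        using sum_abs[of "\<lambda>s. G (z + real s *\<^sub>R x i + x i) - G (z + real s *\<^sub>R x i)" "{..<L}"]
        by (simp only:)
    qed (use p L0 in auto)
    also have "\<dots> \<le> (\<Sum>s<L. h i (z + real s *\<^sub>R x i)) / L"
      unfolding h_def by (rule powr_mean_le[OF p L0']) auto
    finally show ?thesis by simp
  qed
  have drift: "mean zs (h i) (real s *\<^sub>R x i) \<le> mean zs (h i) 0 + real s * (2 * B powr p / N)"
    if i: "i < n" for i s
  proof (induction s)
    case (Suc s)
    have "\<bar>mean zs (h i) (real s *\<^sub>R x i + x i) - mean zs (h i) (real s *\<^sub>R x i)\<bar> \<le> 2 * B powr p / N"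
      unfolding zs_def
      by (rule mean_grid_almost_invariant[OF vs[OF i] N0']) (use h0 hB[OF i] in auto)
    then show ?case using Suc by (simp add: algebra_simps add_divide_distrib)
  qed simp
  have "A \<le> mean zs (\<lambda>z. \<Sum>i<n. ((1 / L) * (\<Sum>s<L. h i (z + real s *\<^sub>R x i)) + \<epsilon>')) 0"
    using main by (intro order_trans[OF A] mean_mono sum_mono) auto
  also have "\<dots> = (\<Sum>i<n. (1 / L) * (\<Sum>s<L. mean zs (h i) (real s *\<^sub>R x i)) + \<epsilon>')"
    by (simp only: mean_sum mean_add mean_cmult mean_shift mean_const[OF zs] add_0)
  also have "\<dots> \<le> (\<Sum>i<n. mean zs (h i) 0 + 2 * \<epsilon>')"
  proof (rule sum_mono)
    fix i assume i: "i \<in> {..<n}"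
    have "mean zs (h i) (real s *\<^sub>R x i) \<le> mean zs (h i) 0 + \<epsilon>'" if "s < L" for s
    proof -
      have "real s * (2 * B powr p / N) \<le> real L * (2 * B powr p / N)"
        using that by (intro mult_right_mono) auto
      also have "\<dots> \<le> \<epsilon>'" using N2 by (simp add: mult_ac)
      finally show ?thesis using drift[of i s] i by simp
    qed
    then have "(\<Sum>s<L. mean zs (h i) (real s *\<^sub>R x i)) \<le> (\<Sum>s<L. mean zs (h i) 0 + \<epsilon>')"
      by (intro sum_mono) auto
    then show "(1 / L) * (\<Sum>s<L. mean zs (h i) (real s *\<^sub>R x i)) + \<epsilon>' \<le> mean zs (h i) 0 + 2 * \<epsilon>'"
      using L0 by (simp add: field_simps)
  qed
  also have "\<dots> = mean zs (\<lambda>z. \<Sum>i<n. h i z) 0 + 2 * n * \<epsilon>'"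
    by (simp add: mean_sum sum.distrib)
  also have "2 * n * \<epsilon>' \<le> \<epsilon> / 2" using eps by (simp add: \<epsilon>'_def field_simps)
  finally have A2: "A \<le> mean zs (\<lambda>z. \<Sum>i<n. h i z) 0 + \<epsilon> / 2" by simp
  have "\<exists>z. A - \<epsilon> \<le> (\<Sum>i<n. h i z)"
  proof (rule ccontr)
    assume "\<not> ?thesis"
    then have "mean zs (\<lambda>z. \<Sum>i<n. h i z) 0 \<le> mean zs (\<lambda>z. A - \<epsilon>) 0"
      by (intro mean_mono) (simp add: not_le less_imp_le)
    then show False using A2 eps by (simp add: mean_const[OF zs])
  qed
  then obtain z where z: "A - \<epsilon> \<le> (\<Sum>i<n. h i z)" by blast
  show ?thesis
  proof (intro exI[of _ "\<lambda>v. G (z + v) - G z"] conjI allI ballI)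
    show "\<bar>G (z + u) - G z - (G (z + v) - G z)\<bar> \<le> norm (u - v)" for u v
      using Gl[of "z + u" "z + v"] by simp
    show "\<bar>G (z + (u + v)) - G z - (G (z + u) - G z) - (G (z + v) - G z)\<bar> \<le> \<epsilon> * norm u"
      if "v \<in> set vs" for u v
      using D[OF that, of z u] by (simp add: add.assoc algebra_simps)
    show "A - \<epsilon> \<le> (\<Sum>i<n. \<bar>G (z + x i) - G z\<bar> powr p)"
      using z by (simp add: h_def)
  qed simp
qed

text \<open>Additivity gives homogeneity for integers. For a real factor \<open>c\<close> compare \<open>m c\<close> with its integer
  part: the discrepancy stays bounded while \<open>m\<close> grows.\<close>

lemma additive_lipschitz_imp_blinfun:
  fixes \<psi> :: "'a::real_normed_vector \<Rightarrow> real"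
  assumes add: "\<And>u v. \<psi> (u + v) = \<psi> u + \<psi> v" and lip: "\<And>u. \<bar>\<psi> u\<bar> \<le> norm u"
  obtains \<phi> :: "'a \<Rightarrow>\<^sub>L real" where "norm \<phi> \<le> 1" "\<And>u. blinfun_apply \<phi> u = \<psi> u"
proof -
  have zero: "\<psi> 0 = 0" using add[of 0 0] by simp
  have neg: "\<psi> (- u) = - \<psi> u" for u using add[of u "- u"] zero by simp
  have nat: "\<psi> (real k *\<^sub>R u) = real k * \<psi> u" for k u
    by (induction k) (simp_all add: zero add algebra_simps)
  have int: "\<psi> (of_int k *\<^sub>R u) = of_int k * \<psi> u" for k u
  proof (cases k)
    case (nonneg m) then show ?thesis using nat[of m u] by simp
  next
    case (neg m) then show ?thesis using nat[of "Suc m" u] \<open>\<And>u. \<psi> (- u) = - \<psi> u\<close>[of "real (Suc m) *\<^sub>R u"] by (simp del: of_nat_Suc)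
  qed
  have scale: "\<psi> (c *\<^sub>R u) = c * \<psi> u" for c u
  proof -
    have bound: "real m * \<bar>\<psi> (c *\<^sub>R u) - c * \<psi> u\<bar> \<le> 2 * norm u" for m :: nat
    proof -
      define k where "k = \<lfloor>real m * c\<rfloor>"
      have k: "\<bar>real m * c - of_int k\<bar> \<le> 1" unfolding k_def by linarith
      have "real m * (\<psi> (c *\<^sub>R u) - c * \<psi> u)
          = \<psi> ((real m * c - of_int k) *\<^sub>R u) - (real m * c - of_int k) * \<psi> u"
      proof -
        have "real m * \<psi> (c *\<^sub>R u) = \<psi> ((real m * c - of_int k) *\<^sub>R u + of_int k *\<^sub>R u)"
          unfolding nat[symmetric] by (simp add: algebra_simps)
        then show ?thesis by (simp only: add int) (simp add: algebra_simps)
      qed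
      moreover have "\<bar>\<psi> ((real m * c - of_int k) *\<^sub>R u)\<bar> \<le> norm u"
        using lip[of "(real m * c - of_int k) *\<^sub>R u"] mult_right_mono[OF k, of "norm u"] by simp
      moreover have "\<bar>(real m * c - of_int k) * \<psi> u\<bar> \<le> norm u"
        using mult_mono[OF k lip[of u]] by (simp add: abs_mult)
      ultimately have "\<bar>real m * (\<psi> (c *\<^sub>R u) - c * \<psi> u)\<bar> \<le> 2 * norm u" by linarith
      then show ?thesis by (simp add: abs_mult)
    qed
    have "\<bar>\<psi> (c *\<^sub>R u) - c * \<psi> u\<bar> \<le> 0"
    proof (rule ccontr)
      assume "\<not> ?thesis"
      then have pos: "0 < \<bar>\<psi> (c *\<^sub>R u) - c * \<psi> u\<bar>" by simp
      obtain m :: nat where "2 * norm u / \<bar>\<psi> (c *\<^sub>R u) - c * \<psi> u\<bar> < m"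
        using reals_Archimedean2 by blast
      then show False using bound[of m] pos by (simp add: field_simps)
    qed
    then show ?thesis by simp
  qed
  have bl: "bounded_linear \<psi>"
    by (rule bounded_linear_intro[of _ 1]) (use add scale lip in auto)
  show thesis
  proof (rule that[of "Blinfun \<psi>"])
    show "norm (Blinfun \<psi>) \<le> 1"
      using lip by (intro norm_blinfun_bound) (simp_all add: bounded_linear_Blinfun_apply[OF bl])
  qed (simp add: bounded_linear_Blinfun_apply[OF bl])
qed

text \<open>Additivity at one pair of vectors, up to a given error, is a closed condition on \<open>\<psi>\<close> in the
  compact product of the intervals \<open>[-\<parallel>u\<parallel>, \<parallel>u\<parallel>]\<close>, and so is having large energy at the points
  \<open>x i\<close>. Finitely many such conditions can be met together by
  \<open>exists_almost_additive_lipschitz\<close>, so by compactness they all can. Because every vector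
  of the space occurs among the directions, the limit is linear on the whole space and not just on the
  span of the \<open>x i\<close>.\<close>

lemma linear_functional_of_lipschitz_energy:
  fixes x :: "nat \<Rightarrow> 'a::real_normed_vector"
  assumes p: "1 \<le> p"
    and energy: "\<And>zs (L::nat). zs \<noteq> [] \<Longrightarrow> 0 < L \<Longrightarrow> \<exists>f. 1-lipschitz_on UNIV f \<and>
      A \<le> mean zs (\<lambda>z. \<Sum>i<n. (\<bar>f (z + real L *\<^sub>R x i) - f z\<bar> / L) powr p) 0"
  obtains \<phi> :: "'a \<Rightarrow>\<^sub>L real" where "norm \<phi> \<le> 1" "A \<le> (\<Sum>i<n. \<bar>blinfun_apply \<phi> (x i)\<bar> powr p)"
proof -
  define K where "K = (\<Pi>\<^sub>E u\<in>(UNIV::'a set). cball (0::real) (norm u))"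
  have K: "compact K"
  proof -
    have "compactin (product_topology (\<lambda>_. euclidean) UNIV) K"
      unfolding K_def by (subst compactin_PiE) (auto simp: compactin_euclidean_iff)
    then show ?thesis by (simp add: euclidean_product_topology compactin_euclidean_iff)
  qed
  define S where "S = (\<lambda>(u, v, e). {\<psi> :: 'a \<Rightarrow> real. \<bar>\<psi> (u + v) - \<psi> u - \<psi> v\<bar> \<le> e * norm u \<and>
      A - e \<le> (\<Sum>i<n. \<bar>\<psi> (x i)\<bar> powr p)})"
  have closed: "closed (S t)" for t
  proof -
    obtain u v e where t: "t = (u, v, e)" by (metis prod_cases3)
    have "closed {\<psi> :: 'a \<Rightarrow> real. \<bar>\<psi> (u + v) - \<psi> u - \<psi> v\<bar> \<le> e * norm u}"
      by (intro closed_Collect_le continuous_intros continuous_on_product_coordinates)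
    moreover have "closed {\<psi> :: 'a \<Rightarrow> real. A - e \<le> (\<Sum>i<n. \<bar>\<psi> (x i)\<bar> powr p)}"
      using p by (intro closed_Collect_le continuous_on_sum continuous_on_powr' continuous_on_const
          continuous_on_rabs continuous_on_product_coordinates) auto
    ultimately show ?thesis by (simp add: S_def t Collect_conj_eq closed_Int)
  qed
  define I where "I = {t :: 'a \<times> 'a \<times> real. 0 < snd (snd t)}"
  have "K \<inter> (\<Inter>t\<in>I. S t) \<noteq> {}"
  proof (rule compact_imp_fip_image[OF K])
    fix J assume J: "finite J" "J \<subseteq> I"
    obtain vs where vs: "set vs = (\<lambda>t. fst (snd t)) ` J \<union> x ` {..<n}"
      using finite_list[of "(\<lambda>t. fst (snd t)) ` J \<union> x ` {..<n}"] J(1) by auto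
    \<comment> \<open>The 1 keeps the minimum meaningful for an empty family.\<close>
    define e where "e = Min (insert 1 ((\<lambda>t. snd (snd t)) ` J))"
    have e: "0 < e" "\<And>t. t \<in> J \<Longrightarrow> e \<le> snd (snd t)"
      using J by (auto simp: e_def I_def)
    obtain \<psi> :: "'a \<Rightarrow> real" where \<psi>: "\<psi> 0 = 0" "\<And>u v. \<bar>\<psi> u - \<psi> v\<bar> \<le> norm (u - v)"
      "\<And>u v. v \<in> set vs \<Longrightarrow> \<bar>\<psi> (u + v) - \<psi> u - \<psi> v\<bar> \<le> e * norm u"
      "A - e \<le> (\<Sum>i<n. \<bar>\<psi> (x i)\<bar> powr p)"
    proof -
      have "\<exists>\<psi>::'a \<Rightarrow> real. \<psi> 0 = 0 \<and> (\<forall>u v. \<bar>\<psi> u - \<psi> v\<bar> \<le> norm (u - v)) \<and>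
          (\<forall>v\<in>set vs. \<forall>u. \<bar>\<psi> (u + v) - \<psi> u - \<psi> v\<bar> \<le> e * norm u) \<and>
          A - e \<le> (\<Sum>i<n. \<bar>\<psi> (x i)\<bar> powr p)"
        by (rule exists_almost_additive_lipschitz[OF p e(1) _ energy]) (simp_all add: vs)
      then show thesis using that by metis
    qed
    have "\<psi> \<in> K" using \<psi>(2)[of _ 0] \<psi>(1) by (auto simp: K_def)
    moreover have "\<psi> \<in> S t" if t: "t \<in> J" for t
    proof -
      obtain u v d where tt: "t = (u, v, d)" by (metis prod_cases3)
      have v: "v \<in> set vs" using t tt vs by force
      have "e \<le> d" using e(2)[OF t] tt by simp
      then have "e * norm u \<le> d * norm u" by (intro mult_right_mono) auto
      then show ?thesis using \<psi>(3)[OF v, of u] \<psi>(4) \<open>e \<le> d\<close> by (simp add: S_def tt)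
    qed
    ultimately show "K \<inter> (\<Inter>t\<in>J. S t) \<noteq> {}" by blast
  qed (use closed in auto)
  then obtain \<psi> where \<psi>K: "\<psi> \<in> K" and \<psi>I: "\<psi> \<in> (\<Inter>t\<in>I. S t)" by blast
  have \<psi>: "\<psi> \<in> S (u, v, e)" if "0 < e" for u v e
    using \<psi>I that by (simp add: I_def)
  have add: "\<psi> (u + v) = \<psi> u + \<psi> v" for u v
  proof -
    have "\<bar>\<psi> (u + v) - \<psi> u - \<psi> v\<bar> \<le> d" if d: "0 < d" for d
    proof -
      \<comment> \<open>The \<open>+ 1\<close> covers \<open>u = 0\<close>.\<close>
      have "\<bar>\<psi> (u + v) - \<psi> u - \<psi> v\<bar> \<le> d / (norm u + 1) * norm u"
        using \<psi>[of "d / (norm u + 1)" u v] d by (simp add: S_def add_nonneg_pos)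
      also have "\<dots> \<le> d" using d by (simp add: divide_simps add_nonneg_pos mult_left_mono)
      finally show ?thesis .
    qed
    then have "\<bar>\<psi> (u + v) - \<psi> u - \<psi> v\<bar> \<le> 0" by (metis field_le_epsilon add_0)
    then show ?thesis by simp
  qed
  have "A \<le> (\<Sum>i<n. \<bar>\<psi> (x i)\<bar> powr p)"
  proof (rule field_le_epsilon)
    show "A \<le> (\<Sum>i<n. \<bar>\<psi> (x i)\<bar> powr p) + d" if "0 < d" for d
      using \<psi>[OF that, of 0 0] by (simp add: S_def)
  qed
  moreover have "\<bar>\<psi> u\<bar> \<le> norm u" for u
  proof -
    have "\<psi> u \<in> cball 0 (norm u)" using \<psi>K unfolding K_def by (rule PiE_mem) simp
    then show ?thesis by simp
  qed
  moreover obtain \<phi> :: "'a \<Rightarrow>\<^sub>L real" where "norm \<phi> \<le> 1" "\<And>u. blinfun_apply \<phi> u = \<psi> u"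
    using additive_lipschitz_imp_blinfun[OF add calculation(2)] by blast
  ultimately show thesis using that by simp
qed

section \<open>Norming functionals\<close>

text \<open>The map \<open>t y \<mapsto> t \<parallel>y\<parallel>\<close> is 1-Lipschitz on the line through \<open>y\<close>; let \<open>f\<close> be its largest 1-Lipschitz
  extension \<open>f z = inf\<^sub>t (t \<parallel>y\<parallel> + \<parallel>z - t y\<parallel>)\<close>. Substituting in the infimum shows that \<open>f\<close> grows by at
  least \<open>c \<parallel>y\<parallel>\<close> under translation by \<open>c y\<close>, at every base point. So all its difference quotients in
  the direction \<open>y\<close> are at least \<open>\<parallel>y\<parallel>\<close>, and \<open>linear_functional_of_lipschitz_energy\<close>, applied
  to this single vector with exponent 1, gives a linear functional that norms \<open>y\<close> up to sign.\<close>

lemma norming_functional: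
  fixes y :: "'a::real_normed_vector"
  obtains \<phi> :: "'a \<Rightarrow>\<^sub>L real" where "norm \<phi> \<le> 1" "blinfun_apply \<phi> y = norm y"
proof -
  define f where "f z = (INF t. t * norm y + norm (z - t *\<^sub>R y))" for z
  have bdd: "bdd_below (range (\<lambda>t. t * norm y + norm (z - t *\<^sub>R y)))" for z
  proof (rule bdd_belowI2)
    fix t
    have "\<bar>t\<bar> * norm y \<le> norm z + norm (z - t *\<^sub>R y)"
      using norm_triangle_ineq4[of z "z - t *\<^sub>R y"] by simp
    moreover have "- \<bar>t\<bar> * norm y \<le> t * norm y" by (intro mult_right_mono) auto
    ultimately show "- norm z \<le> t * norm y + norm (z - t *\<^sub>R y)" by linarith
  qed
  have f_le: "f z \<le> t * norm y + norm (z - t *\<^sub>R y)" for z t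
    unfolding f_def by (rule cINF_lower[OF bdd]) simp
  have le: "f u \<le> f v + norm (u - v)" for u v
  proof -
    have "f u - norm (u - v) \<le> f v"
      unfolding f_def[of v]
    proof (rule cINF_greatest)
      fix t
      show "f u - norm (u - v) \<le> t * norm y + norm (v - t *\<^sub>R y)"
        using f_le[of u t] norm_triangle_ineq[of "u - v" "v - t *\<^sub>R y"] by simp
    qed simp
    then show ?thesis by simp
  qed
  have lip: "1-lipschitz_on UNIV f"
  proof (rule lipschitz_onI)
    show "dist (f u) (f v) \<le> 1 * dist u v" for u v
      using le[of u v] le[of v u] by (simp add: dist_norm norm_minus_commute abs_le_iff)
  qed simp
  have shift: "f z + c * norm y \<le> f (z + c *\<^sub>R y)" for z c
    unfolding f_def[of "z + c *\<^sub>R y"]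
  proof (rule cINF_greatest)
    fix t
    show "f z + c * norm y \<le> t * norm y + norm (z + c *\<^sub>R y - t *\<^sub>R y)"
      using f_le[of z "t - c"] by (simp add: algebra_simps)
  qed simp
  obtain \<phi> :: "'a \<Rightarrow>\<^sub>L real" where \<phi>: "norm \<phi> \<le> 1"
    "norm y \<le> (\<Sum>i<1::nat. \<bar>blinfun_apply \<phi> ((\<lambda>_. y) i)\<bar> powr 1)"
  proof (rule linear_functional_of_lipschitz_energy[where p = 1 and A = "norm y" and n = 1 and x = "\<lambda>_. y"])
    fix zs :: "'a list" and L :: nat assume zs: "zs \<noteq> []" and L: "0 < L"
    have "norm y \<le> (\<bar>f (z + real L *\<^sub>R y) - f z\<bar> / L) powr 1" for z
    proof -
      have "norm y * L \<le> \<bar>f (z + real L *\<^sub>R y) - f z\<bar>"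
        using shift[of z L] by (simp add: mult.commute)
      then show ?thesis using L by (simp add: pos_le_divide_eq)
    qed
    then have "mean zs (\<lambda>_. norm y) 0
        \<le> mean zs (\<lambda>z. \<Sum>i<1::nat. (\<bar>f (z + real L *\<^sub>R y) - f z\<bar> / L) powr 1) 0"
      by (intro mean_mono) simp
    then show "\<exists>f. 1-lipschitz_on UNIV f \<and> norm y \<le> mean zs (\<lambda>z. \<Sum>i<1::nat.
        (\<bar>f (z + real L *\<^sub>R y) - f z\<bar> / L) powr 1) 0"
      using lip by (auto simp: mean_const[OF zs])
  qed auto
  have "\<bar>blinfun_apply \<phi> y\<bar> \<le> norm y"
    using norm_blinfun[of \<phi> y] mult_right_mono[OF \<phi>(1), of "norm y"] by simp
  then have "\<bar>blinfun_apply \<phi> y\<bar> = norm y" using \<phi>(2) by simp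
  then show thesis
    using that[of \<phi>] that[of "- \<phi>"] \<phi>(1) by (cases "0 \<le> blinfun_apply \<phi> y") (auto simp: blinfun.minus_left)
qed

lemma blinfun_separates:
  fixes v w :: "'a::real_normed_vector"
  assumes "\<And>\<phi> :: 'a \<Rightarrow>\<^sub>L real. blinfun_apply \<phi> v = blinfun_apply \<phi> w"
  shows "v = w"
proof -
  obtain \<phi> :: "'a \<Rightarrow>\<^sub>L real" where "blinfun_apply \<phi> (v - w) = norm (v - w)"
    by (rule norming_functional)
  then show ?thesis using assms[of \<phi>] by (simp add: blinfun.diff_right)
qed

section \<open>The barycentre map of the Lipschitz-free space\<close>

text \<open>The value at a point of the completion is the common limit along all approximating sequences.\<close>

lemma completion_extension:
  fixes f :: "'a::real_normed_vector \<Rightarrow> 'b::banach"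
  assumes lin: "linear f" and contr: "\<And>x. norm (f x) \<le> norm x"
  obtains F where "linear F" "\<And>a. norm (F a) \<le> norm a" "\<And>x. F (to_completion x) = f x"
proof -
  have seq: "\<exists>s. (\<lambda>n. to_completion (s n)) \<longlonglongrightarrow> a" for a :: "'a completion"
  proof -
    have "a \<in> closure (range to_completion)" by (simp add: dense_to_completion)
    then obtain r where r: "\<And>n. r n \<in> range to_completion" "r \<longlonglongrightarrow> a"
      by (auto simp: closure_sequential)
    then have "\<forall>n. \<exists>x. r n = to_completion x" by blast
    then obtain s where "\<forall>n. r n = to_completion (s n)" by (rule choice[THEN exE])
    then have "r = (\<lambda>n. to_completion (s n))" by blast
    then show ?thesis using r(2) by blast
  qed
  have "\<exists>v. \<forall>s. (\<lambda>n. to_completion (s n)) \<longlonglongrightarrow> a \<longrightarrow> (\<lambda>n. f (s n)) \<longlonglongrightarrow> v" for a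
  proof -
    obtain s where s: "(\<lambda>n. to_completion (s n)) \<longlonglongrightarrow> a" using seq by blast
    have "Cauchy (\<lambda>n. to_completion (s n))" using s by (rule LIMSEQ_imp_Cauchy)
    then have "Cauchy s"
      by (simp add: Cauchy_iff flip: linear_diff[OF linear_to_completion])
    moreover have "norm (f u - f v) \<le> norm (u - v)" for u v
      using contr[of "u - v"] by (simp add: linear_diff[OF lin])
    ultimately have "Cauchy (\<lambda>n. f (s n))"
      unfolding Cauchy_iff by (meson order_le_less_trans)
    then obtain v where v: "(\<lambda>n. f (s n)) \<longlonglongrightarrow> v" using Cauchy_convergent convergent_def by blast
    have "(\<lambda>n. f (t n)) \<longlonglongrightarrow> v" if t: "(\<lambda>n. to_completion (t n)) \<longlonglongrightarrow> a" for t
    proof -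
      have "(\<lambda>n. to_completion (t n) - to_completion (s n)) \<longlonglongrightarrow> 0"
        using tendsto_diff[OF t s] by simp
      then have "(\<lambda>n. norm (t n - s n)) \<longlonglongrightarrow> 0"
        by (simp add: tendsto_norm_zero_iff flip: linear_diff[OF linear_to_completion])
          (metis (mono_tags, lifting) norm_to_completion tendsto_cong tendsto_norm_zero_iff always_eventually)
      then have "(\<lambda>n. f (t n) - f (s n)) \<longlonglongrightarrow> 0"
        by (rule Lim_null_comparison[rotated]) (simp add: contr flip: linear_diff[OF lin])
      from tendsto_add[OF this v] show ?thesis by simp
    qed
    then show ?thesis by blast
  qed
  then obtain F where F: "\<And>a s. (\<lambda>n. to_completion (s n)) \<longlonglongrightarrow> a \<Longrightarrow> (\<lambda>n. f (s n)) \<longlonglongrightarrow> F a"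
    by metis
  show thesis
  proof (rule that[of F])
    show "linear F"
    proof
      fix a b :: "'a completion" and c :: real
      obtain s t where s: "(\<lambda>n. to_completion (s n)) \<longlonglongrightarrow> a" and t: "(\<lambda>n. to_completion (t n)) \<longlonglongrightarrow> b"
        using seq by blast
      have "(\<lambda>n. f (s n + t n)) \<longlonglongrightarrow> F (a + b)"
        using tendsto_add[OF s t] by (intro F) (simp add: linear_add[OF linear_to_completion])
      then show "F (a + b) = F a + F b"
        using tendsto_add[OF F[OF s] F[OF t]] by (auto simp: linear_add[OF lin] intro: LIMSEQ_unique)
      have "(\<lambda>n. f (c *\<^sub>R s n)) \<longlonglongrightarrow> F (c *\<^sub>R a)"
        using tendsto_scaleR[OF tendsto_const s] by (intro F) (simp add: linear_cmul[OF linear_to_completion])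
      then show "F (c *\<^sub>R a) = c *\<^sub>R F a"
        using tendsto_scaleR[OF tendsto_const F[OF s]] by (auto simp: linear_cmul[OF lin] intro: LIMSEQ_unique)
    qed
    show "norm (F a) \<le> norm a" for a
    proof -
      obtain s where s: "(\<lambda>n. to_completion (s n)) \<longlonglongrightarrow> a" using seq by blast
      show ?thesis
        using tendsto_norm[OF F[OF s]] tendsto_norm[OF s] contr by (auto intro: LIMSEQ_le)
    qed
    show "F (to_completion x) = f x" for x
      using F[OF tendsto_const, of x] by (simp add: LIMSEQ_const_iff)
  qed
qed

lemma blinfun_in_Lip0:
  fixes \<phi> :: "'a::real_normed_vector \<Rightarrow>\<^sub>L real"
  shows "(norm \<phi>)-lipschitz_on UNIV (blinfun_apply \<phi>)" and "blinfun_apply \<phi> \<in> Lip0"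
proof -
  show "(norm \<phi>)-lipschitz_on UNIV (blinfun_apply \<phi>)"
    by (rule lipschitz_onI) (simp_all add: dist_norm flip: blinfun.diff_right, use norm_blinfun[of \<phi>] in auto)
  then show "blinfun_apply \<phi> \<in> Lip0" by (auto simp: Lip0_def)
qed

text \<open>On molecules the barycentre of \<open>m\<close> is the vector \<open>v\<close> with \<open>\<phi> v = m \<phi>\<close> for all functionals
  \<open>\<phi>\<close>; functionals are Lipschitz functions, so this prescription does not see the representation of
  \<open>m\<close>, and since functionals separate points it determines \<open>v\<close>. The contraction property is the
  pairing of \<open>m\<close> with a functional that norms \<open>v\<close>. Completeness of the space then extends the map to
  the completion.\<close>

lemma barycentre:
  obtains \<beta> :: "'a::banach free_space \<Rightarrow> 'a"
  where "linear \<beta>" "\<And>a. norm (\<beta> a) \<le> norm a" "\<And>x y. \<beta> (fdelta x y) = x - y"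
proof -
  have "\<exists>v. \<forall>\<phi> :: 'a \<Rightarrow>\<^sub>L real. blinfun_apply \<phi> v = rapp (mol_rep m) (Lip_Abs (blinfun_apply \<phi>))"
    for m :: "'a molecule"
  proof -
    obtain n l x y where m: "m = (\<Sum>i<n::nat. l i *\<^sub>R mdelta (x i) (y i))"
      using molecule_sum_form by blast
    show ?thesis
      by (rule exI[of _ "\<Sum>i<n. l i *\<^sub>R (x i - y i)"])
         (simp add: m mol_rep_sum scaleR_molecule.rep_eq mdelta.rep_eq delta_def
            Lip_Abs_inverse[OF blinfun_in_Lip0(2)] blinfun.sum_right blinfun.scaleR_right blinfun.diff_right)
  qed
  then obtain b where b: "\<And>m (\<phi> :: 'a \<Rightarrow>\<^sub>L real).
      blinfun_apply \<phi> (b m) = rapp (mol_rep m) (Lip_Abs (blinfun_apply \<phi>))"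
    by metis
  have "linear b"
  proof (rule linearI)
    show "b (m + k) = b m + b k" for m k
      by (rule blinfun_separates) (simp add: b blinfun.add_right plus_molecule.rep_eq)
    show "b (c *\<^sub>R m) = c *\<^sub>R b m" for c m
      by (rule blinfun_separates) (simp add: b blinfun.scaleR_right scaleR_molecule.rep_eq)
  qed
  moreover have "norm (b m) \<le> norm m" for m
  proof -
    obtain \<phi> :: "'a \<Rightarrow>\<^sub>L real" where \<phi>: "norm \<phi> \<le> 1" "blinfun_apply \<phi> (b m) = norm (b m)"
      by (rule norming_functional)
    have lip: "1-lipschitz_on UNIV (lip_app (Lip_Abs (blinfun_apply \<phi>)))"
      using lipschitz_on_le[OF blinfun_in_Lip0(1) \<phi>(1)] by (simp add: Lip_Abs_inverse[OF blinfun_in_Lip0(2)])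
    show ?thesis unfolding norm_molecule_def
    proof (rule cInf_greatest[OF molecule_costs_nonempty])
      fix r assume "r \<in> molecule_costs m"
      from molecule_costs_bound[OF lip this] show "norm (b m) \<le> r"
        using \<phi>(2) by (simp add: b)
    qed
  qed
  ultimately obtain \<beta> where \<beta>: "linear \<beta>" "\<And>a. norm (\<beta> a) \<le> norm a" "\<And>m. \<beta> (to_completion m) = b m"
    using completion_extension[of b] by blast
  have "b (mdelta x y) = x - y" for x y
    by (rule blinfun_separates)
       (simp add: b mdelta.rep_eq delta_def Lip_Abs_inverse[OF blinfun_in_Lip0(2)] blinfun.diff_right)
  then show thesis using that[of \<beta>] \<beta> by (simp add: fdelta_def)
qed

section \<open>Weak and strong sequence norms and the Chevet-Saphar norm\<close>

lemma lp_norm_nonneg: "0 \<le> lp_norm q n g"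
  by (simp add: lp_norm_def)

lemma Hoelder_lp_norm:
  fixes a :: "nat \<Rightarrow> 'a::real_normed_vector" and g :: "nat \<Rightarrow> 'b::real_normed_vector"
  assumes "1 \<le> p"
  shows "(\<Sum>i<n. norm (g i) * norm (a i))
    \<le> (\<Sum>i<n. norm (a i) powr p) powr (1 / p) * lp_norm (conj_exponent p) n g"
proof (cases "p = 1")
  case True
  have "norm (g i) \<le> lp_norm (conj_exponent p) n g" if "i < n" for i
    using that by (auto simp: True conj_exponent_def lp_norm_def intro!: Max_ge)
  then have "(\<Sum>i<n. norm (g i) * norm (a i)) \<le> (\<Sum>i<n. lp_norm (conj_exponent p) n g * norm (a i))"
    by (intro sum_mono mult_right_mono) auto
  then show ?thesis by (simp add: True sum_nonneg sum_distrib_left mult.commute)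
next
  case False
  then show ?thesis
    using Hoelder_powr_sum[of p "\<lambda>i. norm (a i)" "\<lambda>i. norm (g i)" n] assms
    by (simp add: conj_exponent_def lp_norm_def mult.commute)
qed

text \<open>The weights \<open>r\<^sub>i\<^sup>p\<^sup>-\<^sup>1\<close> are those for which Hoelder's inequality is an equality: their \<open>p\<^sup>*\<close>-th powers are
  \<open>r\<^sub>i\<^sup>p\<close>. For \<open>p = 1\<close> the norm is a maximum and the right-hand side is 1.\<close>

lemma lp_norm_conj_dual_le:
  fixes e :: "nat \<Rightarrow> 'b::real_normed_vector"
  assumes p: "1 \<le> p" and e: "\<And>i. norm (e i) \<le> 1" and r: "\<And>i. 0 \<le> r i"
    and pos: "0 < (\<Sum>i<n. r i powr p)"
  shows "lp_norm (conj_exponent p) n (\<lambda>i. (r i powr (p - 1)) *\<^sub>R e i)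
    \<le> (\<Sum>i<n. r i powr p) powr ((p - 1) / p)"
proof (cases "p = 1")
  case True
  then have "norm ((r i powr (p - 1)) *\<^sub>R e i) \<le> 1" for i using e[of i] by simp
  then show ?thesis using True pos by (auto simp: conj_exponent_def lp_norm_def)
next
  case False
  then have p1: "1 < p" using p by simp
  have "(r i powr (p - 1) * norm (e i)) powr (p / (p - 1)) \<le> r i powr p" for i
  proof -
    have "(r i powr (p - 1) * norm (e i)) powr (p / (p - 1)) \<le> (r i powr (p - 1) * 1) powr (p / (p - 1))"
      using p1 e by (intro powr_mono2 mult_left_mono) auto
    then show ?thesis using p1 by (simp add: powr_powr)
  qed
  then have "(\<Sum>i<n. (r i powr (p - 1) * norm (e i)) powr (p / (p - 1))) powr ((p - 1) / p)
      \<le> (\<Sum>i<n. r i powr p) powr ((p - 1) / p)"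
    using p1 by (intro powr_mono2 sum_mono sum_nonneg) auto
  then show ?thesis using p1 by (simp add: conj_exponent_def lp_norm_def)
qed

lemma le_weak_lp_norm:
  fixes x :: "nat \<Rightarrow> 'f::real_normed_vector" and \<phi> :: "'f \<Rightarrow>\<^sub>L real"
  assumes p: "1 \<le> p" and \<phi>: "norm \<phi> \<le> 1"
  shows "(\<Sum>i<n. \<bar>blinfun_apply \<phi> (x i)\<bar> powr p) powr (1 / p) \<le> weak_lp_norm p n x"
  unfolding weak_lp_norm_def
proof (rule cSUP_upper)
  show "\<phi> \<in> {\<phi>. norm \<phi> \<le> 1}" using \<phi> by simp
  show "bdd_above ((\<lambda>\<phi> :: 'f \<Rightarrow>\<^sub>L real. (\<Sum>i<n. \<bar>blinfun_apply \<phi> (x i)\<bar> powr p) powr (1 / p)) ` {\<phi>. norm \<phi> \<le> 1})"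
  proof (rule bdd_aboveI2)
    fix \<phi> :: "'f \<Rightarrow>\<^sub>L real" assume "\<phi> \<in> {\<phi>. norm \<phi> \<le> 1}"
    then have "\<bar>blinfun_apply \<phi> v\<bar> \<le> norm v" for v
      using norm_blinfun[of \<phi> v] mult_right_mono[of "norm \<phi>" 1 "norm v"] by simp
    then show "(\<Sum>i<n. \<bar>blinfun_apply \<phi> (x i)\<bar> powr p) powr (1 / p) \<le> (\<Sum>i<n. norm (x i) powr p) powr (1 / p)"
      using p by (intro powr_mono2 sum_mono sum_nonneg) auto
  qed
qed

lemma weak_lp_norm_le:
  fixes x :: "nat \<Rightarrow> 'f::real_normed_vector"
  assumes "\<And>\<phi> :: 'f \<Rightarrow>\<^sub>L real. norm \<phi> \<le> 1 \<Longrightarrow> (\<Sum>i<n. \<bar>blinfun_apply \<phi> (x i)\<bar> powr p) powr (1 / p) \<le> c"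
  shows "weak_lp_norm p n x \<le> c"
  unfolding weak_lp_norm_def by (rule cSUP_least) (use assms in \<open>auto intro: exI[of _ 0]\<close>)

lemma weak_lp_norm_nonneg: "1 \<le> p \<Longrightarrow> 0 \<le> weak_lp_norm p n x"
  by (rule order_trans[OF powr_ge_zero le_weak_lp_norm[where \<phi> = 0]]) simp_all

lemma d_p_le:
  assumes "1 \<le> p"
  shows "d_p p (\<Sum>i<n. x i \<otimes>\<^sub>t g i) \<le> weak_lp_norm p n x * lp_norm (conj_exponent p) n g"
  unfolding d_p_def
proof (rule cInf_lower)
  show "bdd_below {weak_lp_norm p m z * lp_norm (conj_exponent p) m h | m z h.
      (\<Sum>i<n. x i \<otimes>\<^sub>t g i) = (\<Sum>i<m. z i \<otimes>\<^sub>t h i)}"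
    using assms by (intro bdd_belowI[of _ 0]) (auto simp: weak_lp_norm_nonneg lp_norm_nonneg)
qed blast

lemma le_d_p:
  assumes "\<And>n x g. u = (\<Sum>i<n. x i \<otimes>\<^sub>t g i) \<Longrightarrow> c \<le> weak_lp_norm p n x * lp_norm (conj_exponent p) n g"
  shows "c \<le> d_p p u"
  unfolding d_p_def using tensor_sum_form[of u] assms by (intro cInf_greatest) auto

text \<open>The trace pairing with \<open>S\<close> is a bilinear form, so it depends on the tensor only.\<close>

lemma pairing_eq_of_tensor_eq:
  fixes S :: "'f::real_normed_vector \<Rightarrow> 'g::real_normed_vector" and g h :: "nat \<Rightarrow> 'g \<Rightarrow>\<^sub>L real"
  assumes S: "linear S" and eq: "(\<Sum>i<n. x i \<otimes>\<^sub>t g i) = (\<Sum>j<m. z j \<otimes>\<^sub>t h j)"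
  shows "(\<Sum>i<n. blinfun_apply (g i) (S (x i))) = (\<Sum>j<m. blinfun_apply (h j) (S (z j)))"
proof -
  have "bilinear (\<lambda>v (k :: 'g \<Rightarrow>\<^sub>L real). blinfun_apply k (S v))"
    by (simp add: bilinear_def linear_iff linear_add[OF S] linear_cmul[OF S] blinfun.add_right
        blinfun.add_left blinfun.scaleR_right blinfun.scaleR_left)
  then have "bil_app (Bil_Abs (\<lambda>v (k :: 'g \<Rightarrow>\<^sub>L real). blinfun_apply k (S v))) v k = blinfun_apply k (S v)" for v k
    by (simp add: Bil_Abs_inverse)
  then show ?thesis
    using arg_cong[OF eq, of "\<lambda>u. rapp (tensor_rep u) (Bil_Abs (\<lambda>v k. blinfun_apply k (S v)))"]
    by (simp add: tensor_rep_sum)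
qed

section \<open>Lipschitz summing implies summing\<close>

text \<open>Since the trace pairing depends on the tensor only, it may be estimated on an arbitrary
  representation; there Hoelder's inequality separates the two sequences.\<close>

lemma p_summing_const_if_weak_estimate:
  assumes p: "1 \<le> p" and S: "linear S" and C: "0 < C"
    and weak: "\<And>n x. (\<Sum>i<n. norm (S (x i)) powr p) powr (1 / p) \<le> C * weak_lp_norm p n x"
  shows "p_summing_const p S C"
  unfolding p_summing_const_def
proof (intro conjI allI C)
  fix n x and g :: "nat \<Rightarrow> 'b \<Rightarrow>\<^sub>L real"
  let ?a = "\<Sum>i<n. blinfun_apply (g i) (S (x i))"
  have "\<bar>?a\<bar> / C \<le> d_p p (\<Sum>i<n. x i \<otimes>\<^sub>t g i)"
  proof (rule le_d_p)
    fix m z and h :: "nat \<Rightarrow> 'b \<Rightarrow>\<^sub>L real"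
    assume "(\<Sum>i<n. x i \<otimes>\<^sub>t g i) = (\<Sum>j<m. z j \<otimes>\<^sub>t h j)"
    then have "?a = (\<Sum>j<m. blinfun_apply (h j) (S (z j)))" by (rule pairing_eq_of_tensor_eq[OF S])
    then have "\<bar>?a\<bar> \<le> (\<Sum>j<m. \<bar>blinfun_apply (h j) (S (z j))\<bar>)" by (simp add: sum_abs)
    also have "\<dots> \<le> (\<Sum>j<m. norm (h j) * norm (S (z j)))"
      by (intro sum_mono) (use norm_blinfun in \<open>metis real_norm_def\<close>)
    also have "\<dots> \<le> (\<Sum>j<m. norm (S (z j)) powr p) powr (1 / p) * lp_norm (conj_exponent p) m h"
      by (rule Hoelder_lp_norm[OF p])
    also have "\<dots> \<le> (C * weak_lp_norm p m z) * lp_norm (conj_exponent p) m h"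
      by (intro mult_right_mono weak lp_norm_nonneg)
    finally show "\<bar>?a\<bar> / C \<le> weak_lp_norm p m z * lp_norm (conj_exponent p) m h"
      using C by (simp add: field_simps)
  qed
  then show "\<bar>?a\<bar> \<le> C * d_p p (\<Sum>i<n. x i \<otimes>\<^sub>t g i)" using C by (simp add: field_simps)
qed

lemma lipschitz_p_summing_const_finite:
  assumes T: "lipschitz_p_summing_const p T C" and I: "finite I"
  shows "(\<Sum>i\<in>I. norm (T (x i) - T (y i)) powr p)
    \<le> C powr p * (SUP f\<in>{f :: 'a::{metric_space,zero} \<Rightarrow> real. f \<in> Lip0 \<and> 1-lipschitz_on UNIV f}.
        \<Sum>i\<in>I. \<bar>f (x i) - f (y i)\<bar> powr p)"
proof -
  obtain b where b: "bij_betw b {0..<card I} I" using ex_bij_betw_nat_finite[OF I] by blast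
  have "sum h I = (\<Sum>k<card I. h (b k))" for h :: "_ \<Rightarrow> real"
    using sum.reindex_bij_betw[OF b, of h] by (simp add: atLeast0LessThan)
  then show ?thesis
    using T unfolding lipschitz_p_summing_const_def by simp
qed

text \<open>Apply the summing inequality to the pairs \<open>(z + L x\<^sub>i, z)\<close>. By linearity of \<open>T\<close> the left-hand side
  is the same for every \<open>z\<close>, so the supremum on the right is at least the number of points \<open>z\<close> times a
  fixed amount, and a function that comes near it has large energy in the mean over \<open>z\<close>. The
  strict inequality in the hypothesis makes up for a supremum that need not be attained.\<close>

lemma lipschitz_p_summing_energy:
  fixes T :: "'a::real_normed_vector \<Rightarrow> 'b::real_normed_vector" and x :: "nat \<Rightarrow> 'a"
  assumes p: "1 \<le> p" and lin: "linear T" and T: "lipschitz_p_summing_const p T C"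
    and A: "C powr p * A < (\<Sum>i<n. norm (T (x i)) powr p)" and zs: "zs \<noteq> []" and L: "0 < (L::nat)"
  shows "\<exists>f. 1-lipschitz_on UNIV f \<and>
      A \<le> mean zs (\<lambda>z. \<Sum>i<n. (\<bar>f (z + real L *\<^sub>R x i) - f z\<bar> / L) powr p) 0"
proof (rule ccontr)
  assume none: "\<not> ?thesis"
  let ?I = "{..<length zs} \<times> {..<n}"
  let ?Lip = "{f :: 'a \<Rightarrow> real. f \<in> Lip0 \<and> 1-lipschitz_on UNIV f}"
  let ?s = "real (length zs)" and ?l = "real L powr p"
  define u where "u = (\<lambda>(k, i::nat). zs ! k + real L *\<^sub>R x i)"
  define v where "v = (\<lambda>(k, i::nat). zs ! k)"
  have s: "0 < ?s" using zs by simp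
  have l: "0 < ?l" using L by simp
  have C: "0 < C powr p" using T by (simp add: lipschitz_p_summing_const_def)
  have prod_sum: "sum h ?I = (\<Sum>k<length zs. \<Sum>i<n. h (k, i))" for h :: "nat \<times> nat \<Rightarrow> real"
    by (simp add: sum.cartesian_product)
  have "(\<Sum>t\<in>?I. norm (T (u t) - T (v t)) powr p) = ?s * (?l * (\<Sum>i<n. norm (T (x i)) powr p))"
    by (simp add: prod_sum u_def v_def linear_add[OF lin] linear_cmul[OF lin] powr_mult sum_distrib_left)
  moreover have "(SUP f\<in>?Lip. \<Sum>t\<in>?I. \<bar>f (u t) - f (v t)\<bar> powr p) \<le> ?s * (?l * A)"
  proof (rule cSUP_least)
    show "?Lip \<noteq> {}" by (auto simp: Lip0_def lipschitz_on_def intro!: exI[of _ "\<lambda>_. 0"] exI[of _ 1])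
    fix f assume "f \<in> ?Lip"
    then have "mean zs (\<lambda>z. \<Sum>i<n. (\<bar>f (z + real L *\<^sub>R x i) - f z\<bar> / L) powr p) 0 < A"
      using none by force
    moreover have "mean zs (\<lambda>z. \<Sum>i<n. (\<bar>f (z + real L *\<^sub>R x i) - f z\<bar> / L) powr p) 0
        = (\<Sum>t\<in>?I. \<bar>f (u t) - f (v t)\<bar> powr p) / ?l / ?s"
      by (simp add: mean_nth prod_sum u_def v_def powr_divide flip: sum_divide_distrib)
    ultimately show "(\<Sum>t\<in>?I. \<bar>f (u t) - f (v t)\<bar> powr p) \<le> ?s * (?l * A)"
      using s l by (simp add: field_simps)
  qed
  ultimately have "?s * (?l * (\<Sum>i<n. norm (T (x i)) powr p)) \<le> C powr p * (?s * (?l * A))"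
    using lipschitz_p_summing_const_finite[OF T, of ?I u v] mult_left_mono[OF _ less_imp_le[OF C]]
    by fastforce
  then have "(?s * ?l) * (\<Sum>i<n. norm (T (x i)) powr p) \<le> (?s * ?l) * (C powr p * A)"
    by (simp add: mult_ac)
  then show False using A s l by (simp add: mult_le_cancel_left_pos)
qed

lemma p_summing_const_if_lipschitz_p_summing:
  fixes T :: "'a::real_normed_vector \<Rightarrow> 'b::real_normed_vector"
  assumes p: "1 \<le> p" and lin: "linear T" and T: "lipschitz_p_summing_const p T C"
  shows "p_summing_const p T C"
proof (rule p_summing_const_if_weak_estimate[OF p lin])
  show C: "0 < C" using T by (simp add: lipschitz_p_summing_const_def)
  fix n and x :: "nat \<Rightarrow> 'a"
  let ?E = "\<Sum>i<n. norm (T (x i)) powr p" and ?w = "weak_lp_norm p n x"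
  have w: "0 \<le> ?w" by (rule weak_lp_norm_nonneg[OF p])
  have "?E \<le> C powr p * ?w powr p"
  proof (rule ccontr)
    assume "\<not> ?thesis"
    then have "?w powr p < ?E / C powr p" using C by (simp add: field_simps)
    \<comment> \<open>A level strictly between the two sides leaves room both for the non-attained supremum over
      Lipschitz functions and for the contradiction with the weak norm.\<close>
    then obtain A where A: "?w powr p < A" "A < ?E / C powr p" using dense by blast
    then have "C powr p * A < ?E" using C by (simp add: field_simps)
    from lipschitz_p_summing_energy[OF p lin T this]
    obtain \<phi> :: "'a \<Rightarrow>\<^sub>L real" where \<phi>: "norm \<phi> \<le> 1" "A \<le> (\<Sum>i<n. \<bar>blinfun_apply \<phi> (x i)\<bar> powr p)"
      using linear_functional_of_lipschitz_energy[OF p, where A = A and n = n and x = x] by blast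
    have "A powr (1 / p) \<le> (\<Sum>i<n. \<bar>blinfun_apply \<phi> (x i)\<bar> powr p) powr (1 / p)"
      using \<phi>(2) A(1) p by (intro powr_mono2) (auto intro: order_trans[OF powr_ge_zero less_imp_le])
    also have "\<dots> \<le> ?w" by (rule le_weak_lp_norm[OF p \<phi>(1)])
    finally have "(A powr (1 / p)) powr p \<le> ?w powr p" using p by (intro powr_mono2) auto
    moreover have "0 \<le> A" using A(1) by (auto intro: order_trans[OF powr_ge_zero less_imp_le])
    ultimately show False using A(1) p by (simp add: powr_powr)
  qed
  then have "?E powr (1 / p) \<le> (C powr p * ?w powr p) powr (1 / p)"
    using p by (intro powr_mono2 sum_nonneg) auto
  also have "\<dots> = C * ?w" using C w p by (simp add: powr_mult powr_powr)
  finally show "?E powr (1 / p) \<le> C * ?w" .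
qed

section \<open>Summing implies strictly Lipschitz summing\<close>

text \<open>Push a representation of the tensor in the free space forward by the barycentre map. Being a
  contraction, it does not increase weak norms, and \<open>T \<circ> \<beta>\<close> takes \<open>\<delta>\<^bsub>(x,y)\<^esub>\<close> to \<open>T x - T y\<close>.\<close>

lemma strictly_lipschitz_p_summing_const_if_p_summing:
  fixes T :: "'a::banach \<Rightarrow> 'b::real_normed_vector"
  assumes p: "1 \<le> p" and lin: "linear T" and T: "p_summing_const p T C"
  shows "strictly_lipschitz_p_summing_const p T C"
  unfolding strictly_lipschitz_p_summing_const_def
proof (intro conjI allI)
  show C: "0 < C" using T by (simp add: p_summing_const_def)
  fix n and x y :: "nat \<Rightarrow> 'a" and e :: "nat \<Rightarrow> 'b \<Rightarrow>\<^sub>L real"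
  obtain \<beta> :: "'a free_space \<Rightarrow> 'a"
    where \<beta>: "linear \<beta>" "\<And>a. norm (\<beta> a) \<le> norm a" "\<And>x y. \<beta> (fdelta x y) = x - y"
    using barycentre by blast
  have blin: "bounded_linear \<beta>"
    using \<beta>(1,2) by (intro bounded_linear_intro[of _ 1]) (auto simp: linear_add linear_cmul)
  have weak: "weak_lp_norm p m (\<lambda>j. \<beta> (z j)) \<le> weak_lp_norm p m z" for m z
  proof (rule weak_lp_norm_le)
    fix \<phi> :: "'a \<Rightarrow>\<^sub>L real" assume \<phi>: "norm \<phi> \<le> 1"
    define \<phi>' where "\<phi>' = \<phi> o\<^sub>L Blinfun \<beta>"
    have app: "blinfun_apply \<phi>' a = blinfun_apply \<phi> (\<beta> a)" for a
      by (simp add: \<phi>'_def bounded_linear_Blinfun_apply[OF blin])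
    have "norm \<phi>' \<le> 1"
    proof (rule norm_blinfun_bound)
      show "norm (blinfun_apply \<phi>' a) \<le> 1 * norm a" for a
        using norm_blinfun[of \<phi> "\<beta> a"] mult_mono[OF \<phi> \<beta>(2)[of a]] by (simp add: app)
    qed simp
    from le_weak_lp_norm[OF p this]
    show "(\<Sum>j<m. \<bar>blinfun_apply \<phi> (\<beta> (z j))\<bar> powr p) powr (1 / p) \<le> weak_lp_norm p m z"
      by (simp add: app)
  qed
  let ?u = "\<Sum>i<n. fdelta (x i) (y i) \<otimes>\<^sub>t e i"
  let ?a = "\<Sum>i<n. blinfun_apply (e i) (T (x i) - T (y i))"
  have lin': "linear (T \<circ> \<beta>)" by (rule linear_compose[OF \<beta>(1) lin])
  have "\<bar>?a\<bar> / C \<le> d_p p ?u"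
  proof (rule le_d_p)
    fix m z and h :: "nat \<Rightarrow> 'b \<Rightarrow>\<^sub>L real" assume "?u = (\<Sum>j<m. z j \<otimes>\<^sub>t h j)"
    from pairing_eq_of_tensor_eq[OF lin' this]
    have "?a = (\<Sum>j<m. blinfun_apply (h j) (T (\<beta> (z j))))"
      by (simp add: \<beta>(3) linear_diff[OF lin])
    then have "\<bar>?a\<bar> \<le> C * d_p p (\<Sum>j<m. \<beta> (z j) \<otimes>\<^sub>t h j)"
      using T by (simp add: p_summing_const_def)
    also have "\<dots> \<le> C * (weak_lp_norm p m (\<lambda>j. \<beta> (z j)) * lp_norm (conj_exponent p) m h)"
      using C by (intro mult_left_mono d_p_le[OF p]) auto
    also have "\<dots> \<le> C * (weak_lp_norm p m z * lp_norm (conj_exponent p) m h)"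
      using C by (intro mult_left_mono mult_right_mono weak lp_norm_nonneg) auto
    finally show "\<bar>?a\<bar> / C \<le> weak_lp_norm p m z * lp_norm (conj_exponent p) m h"
      using C by (simp add: field_simps)
  qed
  then show "\<bar>?a\<bar> \<le> C * d_p_lip p (\<Sum>i<n. delta_box (x i) (y i) (e i))"
    using C by (simp add: d_p_lip_def box_to_tensor_sum field_simps)
qed

section \<open>Strictly Lipschitz summing implies Lipschitz summing\<close>

lemma fdelta_diff: "fdelta x w - fdelta y w = fdelta x y"
proof -
  have "mol_rep (mdelta x w - mdelta y w) = mol_rep (mdelta x y)"
    by (rule rfun_eqI) (simp add: minus_molecule.rep_eq mdelta.rep_eq delta_def)
  then show ?thesis
    by (simp add: fdelta_def mol_rep_inject flip: linear_diff[OF linear_to_completion])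
qed

lemma norm_fdelta_le: "norm (fdelta x y) \<le> dist x y"
proof -
  have "dist x y \<in> molecule_costs (mdelta x y)"
    unfolding molecule_costs_def
    by (intro CollectI exI[of _ "1::nat"] exI[of _ "\<lambda>_. 1::real"] exI[of _ "\<lambda>_. x"] exI[of _ "\<lambda>_. y"]) simp
  then show ?thesis
    by (simp add: fdelta_def norm_molecule_def cInf_lower molecule_costs_bdd)
qed

lemma bdd_above_lipschitz_increments:
  fixes x y :: "nat \<Rightarrow> 'a::{metric_space,zero}"
  assumes "0 \<le> p"
  shows "bdd_above ((\<lambda>f. \<Sum>i<n. \<bar>f (x i) - f (y i)\<bar> powr p) `
    {f :: 'a \<Rightarrow> real. f \<in> Lip0 \<and> 1-lipschitz_on UNIV f})"
proof (rule bdd_aboveI2)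
  fix g :: "'a \<Rightarrow> real" assume "g \<in> {f. f \<in> Lip0 \<and> 1-lipschitz_on UNIV f}"
  then have "\<bar>g u - g v\<bar> \<le> dist u v" for u v using lip_on_dist[of 1 g u v] by simp
  then show "(\<Sum>i<n. \<bar>g (x i) - g (y i)\<bar> powr p) \<le> (\<Sum>i<n. dist (x i) (y i) powr p)"
    using assms by (intro sum_mono powr_mono2) auto
qed

text \<open>A functional \<open>\<phi>\<close> on the free space is integration of the Lipschitz function
  \<open>z \<mapsto> \<phi> \<delta>\<^bsub>(z,0)\<^esub>\<close>, whose Lipschitz constant is at most \<open>\<parallel>\<phi>\<parallel>\<close>.\<close>

lemma weak_lp_norm_fdelta_le:
  fixes x y :: "nat \<Rightarrow> 'a::{metric_space,zero}"
  assumes p: "1 \<le> p"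
  shows "weak_lp_norm p n (\<lambda>i. fdelta (x i) (y i))
    \<le> (SUP f\<in>{f :: 'a \<Rightarrow> real. f \<in> Lip0 \<and> 1-lipschitz_on UNIV f}.
        \<Sum>i<n. \<bar>f (x i) - f (y i)\<bar> powr p) powr (1 / p)"
proof (rule weak_lp_norm_le)
  fix \<phi> :: "'a free_space \<Rightarrow>\<^sub>L real" assume \<phi>: "norm \<phi> \<le> 1"
  let ?Lip = "{f :: 'a \<Rightarrow> real. f \<in> Lip0 \<and> 1-lipschitz_on UNIV f}"
  define f where "f z = blinfun_apply \<phi> (fdelta z 0)" for z
  have f_diff: "f u - f v = blinfun_apply \<phi> (fdelta u v)" for u v
    by (simp add: f_def fdelta_diff flip: blinfun.diff_right)
  have "fdelta (0::'a) 0 = 0" using fdelta_diff[of "0::'a" 0 0] by simp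
  then have f0: "f 0 = 0" by (simp add: f_def)
  have lip: "1-lipschitz_on UNIV f"
  proof (rule lipschitz_onI)
    fix u v
    have "\<bar>f u - f v\<bar> \<le> norm \<phi> * norm (fdelta u v)"
      using norm_blinfun[of \<phi> "fdelta u v"] by (simp add: f_diff)
    also have "\<dots> \<le> 1 * dist u v" by (intro mult_mono \<phi> norm_fdelta_le) auto
    finally show "dist (f u) (f v) \<le> 1 * dist u v" by (simp add: dist_real_def)
  qed simp
  have "(\<Sum>i<n. \<bar>f (x i) - f (y i)\<bar> powr p) \<le> (SUP f\<in>?Lip. \<Sum>i<n. \<bar>f (x i) - f (y i)\<bar> powr p)"
  proof (rule cSUP_upper)
    show "f \<in> ?Lip" using f0 lip by (auto simp: Lip0_def)
    show "bdd_above ((\<lambda>f. \<Sum>i<n. \<bar>f (x i) - f (y i)\<bar> powr p) ` ?Lip)"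
      using p by (intro bdd_above_lipschitz_increments) simp
  qed
  then show "(\<Sum>i<n. \<bar>blinfun_apply \<phi> (fdelta (x i) (y i))\<bar> powr p) powr (1 / p)
      \<le> (SUP f\<in>?Lip. \<Sum>i<n. \<bar>f (x i) - f (y i)\<bar> powr p) powr (1 / p)"
    using p by (intro powr_mono2 sum_nonneg) (auto simp: f_diff)
qed

text \<open>With \<open>e\<^sub>i\<close> norming \<open>a\<^sub>i = T x\<^sub>i - T y\<^sub>i\<close>, the test functionals \<open>\<parallel>a\<^sub>i\<parallel>\<^sup>p\<^sup>-\<^sup>1 e\<^sub>i\<close> turn the pairing into the
  energy \<open>E = (\<Sum>i. \<parallel>a\<^sub>i\<parallel>\<^sup>p)\<close>, while their \<open>p\<^sup>*\<close>-norm is at most \<open>E\<^bsup>(p-1)/p\<^esup>\<close>. Cancelling this factor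
  leaves \<open>E\<^bsup>1/p\<^esup>\<close> on the left.\<close>

lemma lipschitz_p_summing_const_if_strictly:
  fixes T :: "'a::{metric_space,zero} \<Rightarrow> 'b::real_normed_vector"
  assumes p: "1 \<le> p" and T: "strictly_lipschitz_p_summing_const p T C"
  shows "lipschitz_p_summing_const p T C"
  unfolding lipschitz_p_summing_const_def
proof (intro conjI allI)
  show C: "0 < C" using T by (simp add: strictly_lipschitz_p_summing_const_def)
  fix n and x y :: "nat \<Rightarrow> 'a"
  let ?S = "SUP f\<in>{f :: 'a \<Rightarrow> real. f \<in> Lip0 \<and> 1-lipschitz_on UNIV f}. \<Sum>i<n. \<bar>f (x i) - f (y i)\<bar> powr p"
  define a where "a i = T (x i) - T (y i)" for i
  let ?E = "\<Sum>i<n. norm (a i) powr p"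
  have w: "weak_lp_norm p n (\<lambda>i. fdelta (x i) (y i)) \<le> ?S powr (1 / p)"
    by (rule weak_lp_norm_fdelta_le[OF p])
  have S: "0 \<le> ?S"
  proof -
    have "bdd_above ((\<lambda>f. \<Sum>i<n. \<bar>f (x i) - f (y i)\<bar> powr p) `
        {f :: 'a \<Rightarrow> real. f \<in> Lip0 \<and> 1-lipschitz_on UNIV f})"
      using p by (intro bdd_above_lipschitz_increments) simp
    then show ?thesis
      by (rule cSUP_upper2[where x = "\<lambda>_. 0"]) (auto simp: Lip0_def lipschitz_on_def intro!: exI[of _ 1])
  qed
  show "(\<Sum>i<n. norm (T (x i) - T (y i)) powr p) \<le> C powr p * ?S"
  proof (cases "?E = 0")
    case True
    then show ?thesis using S by (simp add: a_def)
  next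
    case False
    then have E: "0 < ?E" by (simp add: less_le sum_nonneg)
    have "\<exists>\<phi> :: 'b \<Rightarrow>\<^sub>L real. norm \<phi> \<le> 1 \<and> blinfun_apply \<phi> (a i) = norm (a i)" for i
      using norming_functional[of "a i"] by metis
    then obtain e where e: "\<And>i. norm (e i :: 'b \<Rightarrow>\<^sub>L real) \<le> 1" "\<And>i. blinfun_apply (e i) (a i) = norm (a i)"
      by metis
    define g where "g i = (norm (a i) powr (p - 1)) *\<^sub>R e i" for i
    have ga: "blinfun_apply (g i) (a i) = norm (a i) powr p" for i
      using powr_mult_base[of "norm (a i)" "p - 1"]
      by (simp add: g_def blinfun.scaleR_left e(2) mult.commute)
    have "?E = \<bar>\<Sum>i<n. blinfun_apply (g i) (T (x i) - T (y i))\<bar>"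
      using E by (simp add: ga flip: a_def)
    also have "\<dots> \<le> C * d_p_lip p (\<Sum>i<n. delta_box (x i) (y i) (g i))"
      using T by (simp add: strictly_lipschitz_p_summing_const_def)
    also have "\<dots> = C * d_p p (\<Sum>i<n. fdelta (x i) (y i) \<otimes>\<^sub>t g i)"
      by (simp add: d_p_lip_def box_to_tensor_sum)
    also have "\<dots> \<le> C * (weak_lp_norm p n (\<lambda>i. fdelta (x i) (y i)) * lp_norm (conj_exponent p) n g)"
      using C by (intro mult_left_mono d_p_le[OF p]) auto
    also have "\<dots> \<le> C * (?S powr (1 / p) * ?E powr ((p - 1) / p))"
      unfolding g_def using C E
      by (intro mult_left_mono mult_mono w lp_norm_conj_dual_le[OF p e(1)] lp_norm_nonneg) auto
    finally have "?E \<le> (C * ?S powr (1 / p)) * ?E powr ((p - 1) / p)" by (simp add: mult.assoc)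
    moreover have "?E = ?E powr (1 / p) * ?E powr ((p - 1) / p)"
    proof -
      have "1 / p + (p - 1) / p = 1" using p by (simp add: field_simps)
      then show ?thesis using E by (simp flip: powr_add)
    qed
    ultimately have "?E powr (1 / p) * ?E powr ((p - 1) / p) \<le> (C * ?S powr (1 / p)) * ?E powr ((p - 1) / p)"
      by simp
    then have "?E powr (1 / p) \<le> C * ?S powr (1 / p)" using E by simp
    then have "(?E powr (1 / p)) powr p \<le> (C * ?S powr (1 / p)) powr p"
      using p by (intro powr_mono2) auto
    then have "?E \<le> C powr p * ?S" using E C S p by (simp add: powr_mult powr_powr)
    then show ?thesis by (simp add: a_def)
  qed
qed

section \<open>The three summing properties coincide for linear operators\<close>

theorem proposition3p8:
  fixes p :: real and T :: "'a::banach \<Rightarrow> 'b::banach"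
  assumes "1 \<le> p" and "bounded_linear T"
  shows "(lipschitz_p_summing p T \<longleftrightarrow> p_summing p T) \<and>
    (p_summing p T \<longleftrightarrow> strictly_lipschitz_p_summing p T) \<and>
    (p_summing p T \<longrightarrow>
       p_summing_norm p T = lipschitz_p_summing_norm p T \<and>
       lipschitz_p_summing_norm p T = strictly_lipschitz_p_summing_norm p T)"
proof -
  have lin: "linear T" using assms(2) by (rule bounded_linear.linear)
  obtain K where "K-lipschitz_on UNIV T" using bounded_linear.lipschitz_boundE[OF assms(2)] by blast
  then have Lip0: "T \<in> Lip0" using linear_0[OF lin] by (auto simp: Lip0_def)
  have "lipschitz_p_summing_const p T = p_summing_const p T"
    and "strictly_lipschitz_p_summing_const p T = p_summing_const p T"
    using p_summing_const_if_lipschitz_p_summing[OF assms(1) lin] lipschitz_p_summing_const_if_strictly[OF assms(1), of T]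
      strictly_lipschitz_p_summing_const_if_p_summing[OF assms(1) lin] by blast+
  then show ?thesis
    using lin Lip0
    by (simp add: lipschitz_p_summing_def p_summing_def strictly_lipschitz_p_summing_def
        p_summing_norm_def lipschitz_p_summing_norm_def strictly_lipschitz_p_summing_norm_def)
qed

end
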